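(* Let $n\ge 1$, let $\mu$ be a positive Borel measure on $\mathbb{C}^n$, and let $p\ge 1$, $\alpha>0$ and $0<r<\infty$ be fixed. Then the following conditions are equivalent: (1) $\mu$ is a $p$-Carleson measure for $\mathcal{PH}^p_\alpha(\mathbb{C}^n)$; (2) there exists a constant $C>0$ such that $\mu(B(a,r))\le C$ for every $a\in\mathbb{C}^n$.
   Context: $dA$ is Lebesgue measure on $\mathbb{C}^n$ and $B(a,r)$ is the Euclidean ball of center $a$ and radius $r$. A function $f:\mathbb{C}^n\to\mathbb{C}$ is pluriharmonic if $\partial^2 f/\partial z_j\partial\bar z_k=0$ for all $j,k$; equivalently $f=g+\bar h$ with $g,h$ entire. $L^p_\alpha$ is the space of measurable $f$ on $\mathbb{C}^n$ with $\|f\|_{p,\alpha}^p=\frac{p^n}{(2\pi\alpha)^n}\int_{\mathbb{C}^n}|f(z)e^{-|z|^2/(2\alpha)}|^p\,dA(z)<\infty$, and $\mathcal{PH}^p_\alpha(\mathbb{C}^n)$ is the subspace of pluriharmonic functions in $L^p_\alpha$. For $1\le p<\infty$, $\mu$ is a $p$-Carleson measure for $\mathcal{PH}^p_\alpha(\mathbb{C}^n)$ if there is a constant $C>0$ such that $\left(\int_{\mathbb{C}^n}|f(z)e^{-|z|^2/(2\alpha)}|^p\,d\mu(z)\right)^{1/p}\le C\|f\|_{p,\alpha}$ for all $f\in\mathcal{PH}^p_\alpha(\mathbb{C}^n)$. *)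

theory Defs
  imports "HOL-Analysis.Analysis"
begin

text \<open>
  Complex n-space is the type \<open>complex ^ 'n\<close> with \<open>'n :: finite\<close> and \<open>n = CARD('n)\<close>; its library
  norm is the Euclidean one, and \<open>axis j 1\<close>, \<open>axis j \<i>\<close> are the directions of the real coordinates
  \<open>x\<^sub>j\<close>, \<open>y\<^sub>j\<close> of \<open>z\<^sub>j = x\<^sub>j + \<i> y\<^sub>j\<close>.
\<close>

definition C1_fun :: "(complex ^ 'n \<Rightarrow> complex) \<Rightarrow> bool" where
  "C1_fun f \<longleftrightarrow>
     (\<forall>z. f differentiable (at z)) \<and>
     (\<forall>v. continuous_on UNIV (\<lambda>z. frechet_derivative f (at z) v))"

definition C2_fun :: "(complex ^ 'n \<Rightarrow> complex) \<Rightarrow> bool" where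
  "C2_fun f \<longleftrightarrow> C1_fun f \<and> (\<forall>v. C1_fun (\<lambda>z. frechet_derivative f (at z) v))"

text \<open>The Wirtinger operators, where the differential of \<open>f\<close> is the real one.\<close>

definition d_z :: "'n \<Rightarrow> (complex ^ 'n \<Rightarrow> complex) \<Rightarrow> complex ^ 'n \<Rightarrow> complex" where
  "d_z j f z =
     (frechet_derivative f (at z) (axis j 1) - \<i> * frechet_derivative f (at z) (axis j \<i>)) / 2"

definition d_zbar :: "'n \<Rightarrow> (complex ^ 'n \<Rightarrow> complex) \<Rightarrow> complex ^ 'n \<Rightarrow> complex" where
  "d_zbar j f z =
     (frechet_derivative f (at z) (axis j 1) + \<i> * frechet_derivative f (at z) (axis j \<i>)) / 2"

text \<open>
  The twofold continuous differentiability implicit in the differential equations is explicit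
  here, since \<open>frechet_derivative\<close> is a junk value where no derivative exists.
\<close>

definition pluriharmonic :: "(complex ^ 'n \<Rightarrow> complex) \<Rightarrow> bool" where
  "pluriharmonic f \<longleftrightarrow> C2_fun f \<and> (\<forall>j k z. d_z j (d_zbar k f) z = 0)"

definition weighted_integral ::
    "real \<Rightarrow> real \<Rightarrow> (complex ^ 'n) measure \<Rightarrow> (complex ^ 'n \<Rightarrow> complex) \<Rightarrow> ennreal" where
  "weighted_integral p \<alpha> M f =
     (\<integral>\<^sup>+ z. ennreal (cmod (f z * of_real (exp (- (norm z)\<^sup>2 / (2 * \<alpha>)))) powr p) \<partial>M)"

definition Lp_space :: "real \<Rightarrow> real \<Rightarrow> (complex ^ 'n \<Rightarrow> complex) set" where
  "Lp_space p \<alpha> = {f \<in> borel_measurable lebesgue. weighted_integral p \<alpha> lebesgue f < \<infinity>}"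

definition Lp_norm :: "real \<Rightarrow> real \<Rightarrow> (complex ^ 'n \<Rightarrow> complex) \<Rightarrow> real" where
  "Lp_norm p \<alpha> f =
     (p ^ CARD('n) / (2 * pi * \<alpha>) ^ CARD('n) * enn2real (weighted_integral p \<alpha> lebesgue f))
       powr (1 / p)"

definition PH_space :: "real \<Rightarrow> real \<Rightarrow> (complex ^ 'n \<Rightarrow> complex) set" where
  "PH_space p \<alpha> = {f \<in> Lp_space p \<alpha>. pluriharmonic f}"

text \<open>
  Real powers are not available on \<open>ennreal\<close>, so finiteness of the integral against \<open>\<mu>\<close>, which the
  inequality entails, is a separate conjunct.
\<close>

definition Carleson_PH :: "real \<Rightarrow> real \<Rightarrow> (complex ^ 'n) measure \<Rightarrow> bool" where
  "Carleson_PH p \<alpha> \<mu> \<longleftrightarrow>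
     (\<exists>C>0. \<forall>f \<in> PH_space p \<alpha>.
        weighted_integral p \<alpha> \<mu> f < \<infinity> \<and>
        enn2real (weighted_integral p \<alpha> \<mu> f) powr (1 / p) \<le> C * Lp_norm p \<alpha> f)"

end

theory Submission
  imports Defs "HOL-Probability.Distributions" "HOL-Complex_Analysis.Cauchy_Integral_Formula"
begin

text \<open>
  That (1) implies (2) is seen by testing on \<open>f\<^sub>a(z) = exp(\<langle>z, a\<rangle>/\<alpha> - |a|\<^sup>2/(2\<alpha>))\<close>, for which
  \<open>|f\<^sub>a(z)| exp(-|z|\<^sup>2/(2\<alpha>)) = exp(-|z - a|\<^sup>2/(2\<alpha>))\<close>.

  For the converse write \<open>f = g + cnj h\<close> with \<open>g\<close>, \<open>h\<close> entire. The Fock projection maps \<open>f\<close> to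
  \<open>g + cnj (h 0)\<close>, which leads to the reproducing formula
  \<open>f(a) = c \<integral> f(z) (exp(\<langle>z, a\<rangle>/\<alpha>) + exp(\<langle>a, z\<rangle>/\<alpha>) - 1) exp(-|z|\<^sup>2/\<alpha>) dA(z)\<close>. With the weights
  moved onto the kernel, it is dominated by the convolution kernel \<open>3 exp(-|z - a|\<^sup>2/(4\<alpha>))\<close>. Jensen's
  inequality and Tonelli's theorem then reduce the Carleson estimate to the uniform boundedness of
  \<open>\<integral> exp(-|z - a|\<^sup>2/(4\<alpha>)) d\<mu>(a)\<close>, which follows from (2) by averaging over balls. The
  decomposition of \<open>f\<close> is only ever needed on single complex lines.
\<close>

section \<open>Lebesgue measure: isometries and Gaussians\<close>

text \<open>The obstacle to the reproducing formula is convergence: \<open>PH_space\<close> imposes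
  an L^p condition on f, which gives no direct control of g and h separately. A crude bound of f by
  a multiple of exp(5|z|^2/(8\<alpha>)), taken from the mean value property on unit balls, stays
  below the exponent 1/\<alpha> of the Gaussian in the formula. On a complex line it passes to g and
  h at the price of a slightly larger exponent. Its constant depends on f, which is harmless, since
  it serves convergence alone and does not enter the final estimate.

  The form of the kernel is dictated by constants: exp(<a,z>/\<alpha>) returns g(a) + cnj (h 0), its
  conjugate returns g(0) + cnj (h a), and the factor 1 returns f(0), so the first two minus the
  third give f(a).

  All these integrals are evaluated by one device. A circle of linear isometries preserves Lebesgue
  measure, so an integrand may be replaced by its average over the circle, and one-variable Cauchy
  theory computes that average. This is why holomorphy along complex lines suffices.\<close>

lemma nn_integral_lborel_shift:
  fixes f :: "'a::euclidean_space \<Rightarrow> ennreal"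
  assumes [measurable]: "f \<in> borel_measurable borel"
  shows "(\<integral>\<^sup>+x. f (a + x) \<partial>lborel) = (\<integral>\<^sup>+x. f x \<partial>lborel)"
proof -
  have "(\<integral>\<^sup>+x. f x \<partial>lborel) = (\<integral>\<^sup>+x. f x \<partial>distr lborel borel ((+) a))"
    by (simp add: lborel_distr_plus)
  then show ?thesis by (simp add: nn_integral_distr)
qed

lemma lborel_integral_shift:
  fixes f :: "'a::euclidean_space \<Rightarrow> 'b::{banach, second_countable_topology}"
  assumes [measurable]: "f \<in> borel_measurable borel"
  shows "(\<integral>x. f (a + x) \<partial>lborel) = (\<integral>x. f x \<partial>lborel)"
proof -
  have "(\<integral>x. f x \<partial>lborel) = (\<integral>x. f x \<partial>distr lborel borel ((+) a))"
    by (simp add: lborel_distr_plus)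
  then show ?thesis by (simp add: integral_distr)
qed

lemma nn_integral_lborel_reflect:
  fixes f :: "'a::euclidean_space \<Rightarrow> ennreal"
  assumes [measurable]: "f \<in> borel_measurable borel"
  shows "(\<integral>\<^sup>+x. f (a - x) \<partial>lborel) = (\<integral>\<^sup>+x. f x \<partial>lborel)"
proof -
  have "lborel = distr lborel borel (\<lambda>x. a - x)"
    using lborel_affine[of "-1" a] by (simp add: density_1)
  then have "(\<integral>\<^sup>+x. f x \<partial>lborel) = (\<integral>\<^sup>+x. f x \<partial>distr lborel borel (\<lambda>x. a - x))"
    by simp
  then show ?thesis by (simp add: nn_integral_distr)
qed

text \<open>Tonelli's theorem gives \<open>\<integral>f dM \<integral>g d\<lambda> = \<integral>g dM \<integral>f d\<lambda>\<close> for every translation-invariant \<open>M\<close>;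
  take for \<open>M\<close> the image of \<open>\<lambda>\<close> under the isometry and for \<open>g\<close> the indicator of the unit ball.\<close>

lemma lborel_distr_isometry:
  fixes T :: "'a::euclidean_space \<Rightarrow> 'a"
  assumes T: "linear T" and nT: "\<And>x. norm (T x) = norm x"
  shows "distr lborel borel T = lborel"
proof -
  have orth: "orthogonal_transformation T"
    using T nT by (simp add: orthogonal_transformation)
  have surj: "surj T" using orth by (rule orthogonal_transformation_surj)
  have inj: "inj T" using orth by (rule orthogonal_transformation_inj)
  have [measurable]: "T \<in> borel_measurable borel"
    by (rule borel_measurable_continuous_onI) (simp add: linear_continuous_on linear_conv_bounded_linear[symmetric] T)
  define M where "M = distr lborel borel T"
  have [measurable_cong, simp]: "sets M = sets borel" by (simp add: M_def)
  have sM: "space M = UNIV" by (simp add: M_def)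
  have nnM: "(\<integral>\<^sup>+x. f x \<partial>M) = (\<integral>\<^sup>+x. f (T x) \<partial>lborel)" if [measurable]: "f \<in> borel_measurable borel" for f
    unfolding M_def by (simp add: nn_integral_distr)
  have shM: "(\<integral>\<^sup>+x. f (x + a) \<partial>M) = (\<integral>\<^sup>+x. f x \<partial>M)" if [measurable]: "f \<in> borel_measurable borel" for f a
  proof -
    obtain b where b: "T b = a" using surj by (metis surjD)
    have "(\<integral>\<^sup>+x. f (x + a) \<partial>M) = (\<integral>\<^sup>+x. f (T (b + x)) \<partial>lborel)"
      by (simp add: nnM b linear_add[OF T] add.commute)
    also have "\<dots> = (\<integral>\<^sup>+x. f (T x) \<partial>lborel)"
      by (rule nn_integral_lborel_shift) measurable
    finally show ?thesis by (simp add: nnM)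
  qed
  have ballM: "emeasure M (ball 0 k) = emeasure lborel (ball (0::'a) k)" for k
  proof -
    have "T -` ball 0 k = ball 0 k" using nT by auto
    then show ?thesis by (simp add: M_def emeasure_distr)
  qed
  interpret M: sigma_finite_measure M
  proof
    let ?A = "range (\<lambda>k::nat. ball (0::'a) (real k))"
    have "countable ?A" by simp
    moreover have "\<Union>?A = space M"
      by (auto simp: sM) (meson reals_Archimedean2)
    moreover have "emeasure M a \<noteq> \<infinity>" if "a \<in> ?A" for a
      using that emeasure_lborel_ball_finite by (auto simp: ballM less_top)
    ultimately show "\<exists>A. countable A \<and> A \<subseteq> sets M \<and> \<Union> A = space M \<and> (\<forall>a\<in>A. emeasure M a \<noteq> \<infinity>)"
      by (intro exI[of _ ?A]) auto
  qed
  interpret P: pair_sigma_finite M "lborel :: 'a measure" ..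
  \<comment> \<open>Substituting x - y for x in the \<open>M\<close>-integral moves the shift from
    \<open>g\<close> to \<open>f\<close>, where the Lebesgue integral over y absorbs it.\<close>
  have swap: "(\<integral>\<^sup>+x. f x \<partial>M) * (\<integral>\<^sup>+x. g x \<partial>lborel) = (\<integral>\<^sup>+x. g x \<partial>M) * (\<integral>\<^sup>+x. f x \<partial>lborel)"
    if [measurable]: "f \<in> borel_measurable borel" "g \<in> borel_measurable borel" for f g
  proof -
    have "(\<integral>\<^sup>+x. f x \<partial>M) * (\<integral>\<^sup>+x. g x \<partial>lborel) = (\<integral>\<^sup>+x. \<integral>\<^sup>+y. f x * g (x + y) \<partial>lborel \<partial>M)"
      by (simp add: nn_integral_cmult nn_integral_multc nn_integral_lborel_shift)
    also have "\<dots> = (\<integral>\<^sup>+y. \<integral>\<^sup>+x. f x * g (x + y) \<partial>M \<partial>lborel)"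
      by (rule P.Fubini'[symmetric]) simp
    also have "\<dots> = (\<integral>\<^sup>+y. \<integral>\<^sup>+x. f (x - y) * g x \<partial>M \<partial>lborel)"
      using shM[of "\<lambda>x. f (x - y) * g x" y for y] by simp
    also have "\<dots> = (\<integral>\<^sup>+x. \<integral>\<^sup>+y. f (x - y) * g x \<partial>lborel \<partial>M)"
      by (rule P.Fubini') simp
    also have "\<dots> = (\<integral>\<^sup>+x. g x \<partial>M) * (\<integral>\<^sup>+x. f x \<partial>lborel)"
      by (simp add: nn_integral_cmult nn_integral_multc nn_integral_lborel_reflect mult.commute)
    finally show ?thesis .
  qed
  have "M = lborel"
  proof (rule measure_eqI)
    fix A assume "A \<in> sets M"
    then have [measurable]: "A \<in> sets borel" by simp
    let ?b = "emeasure lborel (ball (0::'a) 1)"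
    have "?b \<noteq> 0" "?b \<noteq> \<infinity>"
      using emeasure_lborel_ball_finite[of "0::'a" 1] content_ball_pos[of 1 "0::'a"]
      by (auto simp: less_top measure_def)
    moreover have "emeasure M A * ?b = ?b * emeasure lborel A"
      using swap[of "indicator A" "indicator (ball 0 1)"] \<open>A \<in> sets M\<close>
      by (simp add: ballM borel_measurable_indicator)
    ultimately show "emeasure M A = emeasure lborel A"
      by (metis ennreal_mult_cancel_left infinity_ennreal_def mult.commute)
  qed simp
  then show ?thesis by (simp add: M_def)
qed

text \<open>The Gaussian factors over the coordinates, and in one dimension it is a multiple of a
  normal density.\<close>

lemma nn_integral_gaussian_finite:
  fixes a :: "'a::euclidean_space"
  assumes "c > 0"
  shows "(\<integral>\<^sup>+x. ennreal (exp (- c * (norm (x - a))\<^sup>2)) \<partial>lborel) < \<infinity>"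
proof -
  have 1: "(\<integral>\<^sup>+x. ennreal (exp (- c * (x::real)\<^sup>2)) \<partial>lborel) < \<infinity>"
  proof -
    \<comment> \<open>Chosen so that 2\<sigma>^2 = 1/c, which matches the exponent of
      \<open>normal_density 0 \<sigma>\<close>.\<close>
    define \<sigma> where "\<sigma> = sqrt (1 / (2 * c))"
    have \<sigma>: "\<sigma> > 0" "2 * \<sigma>\<^sup>2 = 1 / c" using assms by (auto simp: \<sigma>_def)
    have "integrable lborel (\<lambda>x. sqrt (2 * pi * \<sigma>\<^sup>2) * normal_density 0 \<sigma> x)"
      using \<sigma> by simp
    also have "(\<lambda>x. sqrt (2 * pi * \<sigma>\<^sup>2) * normal_density 0 \<sigma> x) = (\<lambda>x. exp (- c * x\<^sup>2))"
      using \<sigma> by (auto simp: normal_density_def fun_eq_iff)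
    finally show ?thesis
      by (subst nn_integral_eq_integral) auto
  qed
  have "(\<integral>\<^sup>+x. ennreal (exp (- c * (norm (x - a))\<^sup>2)) \<partial>lborel)
      = (\<integral>\<^sup>+x. ennreal (exp (- c * (norm (x::'a))\<^sup>2)) \<partial>lborel)"
    using nn_integral_lborel_shift[of "\<lambda>x. ennreal (exp (- c * (norm (x::'a))\<^sup>2))" "-a"] by simp
  also have "\<dots> = (\<integral>\<^sup>+x. (\<Prod>b\<in>Basis. ennreal (exp (- c * ((x::'a) \<bullet> b)\<^sup>2))) \<partial>lborel)"
  proof (rule nn_integral_cong)
    fix x :: 'a
    have "(norm x)\<^sup>2 = (\<Sum>b\<in>Basis. (x \<bullet> b)\<^sup>2)"
      by (subst power2_norm_eq_inner, subst euclidean_inner) (simp add: power2_eq_square)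
    then show "ennreal (exp (- c * (norm x)\<^sup>2)) = (\<Prod>b\<in>Basis. ennreal (exp (- c * (x \<bullet> b)\<^sup>2)))"
      by (simp add: prod_ennreal exp_sum[symmetric] sum_distrib_left sum_negf)
  qed
  also have "\<dots> = (\<Prod>b\<in>(Basis :: 'a set). \<integral>\<^sup>+x. ennreal (exp (- c * x\<^sup>2)) \<partial>lborel)"
    by (subst nn_integral_lborel_prod) auto
  also have "\<dots> < \<infinity>" using 1 by (simp add: power_less_top_ennreal)
  finally show ?thesis .
qed

section \<open>Harmonic functions of one complex variable\<close>

text \<open>A probability space of angles: circle means become Bochner integrals over it and can be
  exchanged with integrals over the whole space by Fubini's theorem.\<close>

definition unit_interval :: "real measure" where
  "unit_interval = restrict_space lborel {0..1}"

lemma prob_space_unit_interval: "prob_space unit_interval"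
  by (rule prob_spaceI) (simp add: unit_interval_def space_restrict_space emeasure_restrict_space)

interpretation unit_interval: prob_space unit_interval
  by (rule prob_space_unit_interval)

lemma measurable_unit_interval:
  "f \<in> measurable borel M \<Longrightarrow> f \<in> measurable unit_interval M"
  unfolding unit_interval_def by (intro measurable_restrict_space1) simp

lemma integral_unit_interval:
  fixes f :: "real \<Rightarrow> complex"
  assumes "continuous_on {0..1} f"
  shows "integrable unit_interval f" "(\<integral>t. f t \<partial>unit_interval) = integral {0..1} f"
proof -
  have *: "set_integrable lborel {0..1} f"
    using assms by (rule borel_integrable_atLeastAtMost')
  show "integrable unit_interval f"
    using * by (simp add: unit_interval_def integrable_restrict_space set_integrable_def)
  show "(\<integral>t. f t \<partial>unit_interval) = integral {0..1} f"
    using set_borel_integral_eq_integral(2)[OF *]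
    by (simp add: unit_interval_def integral_restrict_space set_lebesgue_integral_def)
qed

lemma norm_circle_mean_le:
  fixes f :: "complex \<Rightarrow> complex"
  assumes f: "continuous_on UNIV f" and B: "\<And>z. norm z = 1 \<Longrightarrow> norm (f z) \<le> B"
  shows "norm (\<integral>t. f (cis (2 * pi * t)) \<partial>unit_interval) \<le> B"
proof -
  have c: "continuous_on {0..1} (\<lambda>t. f (cis (2 * pi * t)))"
    by (intro continuous_on_compose2[OF f] continuous_intros) auto
  show ?thesis
    by (rule integral_norm_bound[THEN order_trans], rule order_trans[OF integral_mono[where g="\<lambda>_. B"]])
       (use integral_unit_interval(1)[OF c] in \<open>auto simp: B unit_interval.prob_space\<close>)
qed

text \<open>Cauchy's integral formula at the centre: the derivative of the circle path is 2 pi i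
  times the path, which cancels the denominator.\<close>

lemma circle_mean_entire:
  assumes "g holomorphic_on UNIV"
  shows "(\<integral>t. g (cis (2 * pi * t)) \<partial>unit_interval) = g 0"
proof -
  have c: "continuous_on {0..1} (\<lambda>t. g (cis (2 * pi * t)))"
    by (intro continuous_on_compose2[OF holomorphic_on_imp_continuous_on[OF assms]] continuous_intros) auto
  have "((\<lambda>u. g u / (u - 0)) has_contour_integral (2 * of_real pi * \<i> * g 0)) (circlepath 0 1)"
    by (rule Cauchy_integral_circlepath_simple) (auto intro: holomorphic_on_subset[OF assms])
  then have "((\<lambda>t. 2 * of_real pi * \<i> * g (cis (2 * pi * t))) has_integral (2 * of_real pi * \<i> * g 0)) {0..1}"
    unfolding has_contour_integral_def
  proof (rule has_integral_eq[rotated])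
    fix t :: real assume t: "t \<in> {0..1}"
    have *: "circlepath 0 1 t = cis (2 * pi * t)" "exp (2 * of_real pi * \<i> * of_real t) = cis (2 * pi * t)"
      by (simp_all add: circlepath cis_conv_exp mult_ac)
    show "g (circlepath 0 1 t) / (circlepath 0 1 t - 0)
        * vector_derivative (circlepath 0 1) (at t within {0..1})
      = 2 * of_real pi * \<i> * g (cis (2 * pi * t))"
      using t by (simp add: vector_derivative_circlepath01 *)
  qed
  then have "((\<lambda>t. inverse (2 * of_real pi * \<i>) * (2 * of_real pi * \<i> * g (cis (2 * pi * t))))
      has_integral (inverse (2 * of_real pi * \<i>) * (2 * of_real pi * \<i> * g 0))) {0..1}"
    by (rule has_integral_mult_right)
  moreover have "inverse (2 * of_real pi * \<i>) * (2 * of_real pi * \<i> * x) = x" for x :: complex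
    by (simp add: field_simps)
  ultimately have "((\<lambda>t. g (cis (2 * pi * t))) has_integral g 0) {0..1}"
    by simp
  then show ?thesis using integral_unit_interval(2)[OF c] by (simp add: integral_unique)
qed

lemma circle_mean_cnj_entire:
  assumes "g holomorphic_on UNIV"
  shows "(\<integral>t. cnj (g (cis (2 * pi * t))) \<partial>unit_interval) = cnj (g 0)"
  using circle_mean_entire[OF assms] by simp

text \<open>The second assumption is the Cauchy-Riemann equation; it makes the real-linear
  differential complex-linear, hence multiplication by \<open>L 1\<close>.\<close>

lemma has_field_derivative_Cauchy_Riemann:
  fixes \<phi> :: "complex \<Rightarrow> complex"
  assumes "(\<phi> has_derivative L) (at z)" "L \<i> = \<i> * L 1"
  shows "(\<phi> has_field_derivative L 1) (at z)"
proof -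
  interpret bounded_linear L using assms(1) by (rule has_derivative_bounded_linear)
  have "L v = L 1 * v" for v
  proof -
    have "L v = L (Re v *\<^sub>R 1 + Im v *\<^sub>R \<i>)"
      by (rule arg_cong[where f=L]) (simp add: complex_eq_iff)
    also have "\<dots> = Re v *\<^sub>R L 1 + Im v *\<^sub>R (\<i> * L 1)" by (simp add: add scaleR assms(2))
    also have "\<dots> = L 1 * v" by (simp add: complex_eq_iff algebra_simps)
    finally show ?thesis .
  qed
  then have "L = (*) (L 1)" by (intro ext)
  then show ?thesis using assms(1) by (metis has_field_derivative_def)
qed

text \<open>Assumption \<open>E\<close> says that the zbar-derivative of \<phi> is antiholomorphic.
  Its conjugate has an entire primitive h, and \<open>cnj h\<close> then has the same
  zbar-derivative as \<phi>, so the difference is entire.\<close>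

lemma holomorphic_plus_antiholomorphic:
  fixes \<phi> :: "complex \<Rightarrow> complex"
  assumes \<phi>: "\<And>z. (\<phi> has_derivative L z) (at z)"
    and E: "(\<lambda>z. cnj ((L z 1 + \<i> * L z \<i>) / 2)) holomorphic_on UNIV"
  obtains g h where "g holomorphic_on UNIV" "h holomorphic_on UNIV" "\<And>z. \<phi> z = g z + cnj (h z)"
proof -
  obtain h where h: "\<And>z. (h has_field_derivative cnj ((L z 1 + \<i> * L z \<i>) / 2)) (at z)"
    using holomorphic_convex_primitive'[OF convex_UNIV open_UNIV E] by auto
  have "((\<lambda>z. \<phi> z - cnj (h z)) has_field_derivative
      (L z 1 - cnj (cnj ((L z 1 + \<i> * L z \<i>) / 2) * 1))) (at z)" for z
  proof (rule has_field_derivative_Cauchy_Riemann[where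
        L = "\<lambda>v. L z v - cnj (cnj ((L z 1 + \<i> * L z \<i>) / 2) * v)" for z])
    show "((\<lambda>z. \<phi> z - cnj (h z)) has_derivative
        (\<lambda>v. L z v - cnj (cnj ((L z 1 + \<i> * L z \<i>) / 2) * v))) (at z)"
      by (intro has_derivative_diff \<phi> has_derivative_cnj h[unfolded has_field_derivative_def])
  qed (simp add: field_simps)
  then have "(\<lambda>z. \<phi> z - cnj (h z)) holomorphic_on UNIV"
    by (auto simp: holomorphic_on_def field_differentiable_def)
  moreover have "h holomorphic_on UNIV"
    using h by (auto simp: holomorphic_on_def field_differentiable_def)
  ultimately show ?thesis by (intro that[of "\<lambda>z. \<phi> z - cnj (h z)" h]) auto
qed

lemma mult_exp_shifted_square_bound:
  fixes c d :: real
  assumes "0 \<le> c" "c < d"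
  shows "\<exists>D>0. \<forall>x\<ge>0. x * exp (c * (x + 1)\<^sup>2) \<le> D * exp (d * x\<^sup>2)"
proof (intro exI conjI allI impI)
  define \<epsilon> where "\<epsilon> = d - c"
  have \<epsilon>: "\<epsilon> > 0" "d = c + \<epsilon>" using assms by (auto simp: \<epsilon>_def)
  \<comment> \<open>The maximum over x of x + c (x + 1)^2 - d x^2, found by completing the square;
    the factor x itself is absorbed through x \<le> exp x.\<close>
  define K where "K = (2 * c + 1)\<^sup>2 / (4 * \<epsilon>) + c"
  show "exp K > 0" by simp
  fix x :: real assume "0 \<le> x"
  have "x + c * (x + 1)\<^sup>2 \<le> K + d * x\<^sup>2"
  proof -
    have "0 \<le> (2 * \<epsilon> * x - (2 * c + 1))\<^sup>2 / (4 * \<epsilon>)" using \<epsilon> by simp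
    also have "\<dots> = (4 * \<epsilon> * (\<epsilon> * x\<^sup>2 - (2 * c + 1) * x) + (2 * c + 1)\<^sup>2) / (4 * \<epsilon>)"
      by (simp add: power2_eq_square algebra_simps)
    also have "\<dots> = \<epsilon> * x\<^sup>2 - (2 * c + 1) * x + (2 * c + 1)\<^sup>2 / (4 * \<epsilon>)"
      using \<epsilon> by (simp add: add_divide_distrib)
    finally show ?thesis by (simp add: K_def \<epsilon> power2_eq_square algebra_simps)
  qed
  then have "exp x * exp (c * (x + 1)\<^sup>2) \<le> exp K * exp (d * x\<^sup>2)"
    by (simp add: exp_add[symmetric])
  moreover have "x \<le> exp x" using exp_ge_add_one_self[of x] by linarith
  ultimately show "x * exp (c * (x + 1)\<^sup>2) \<le> exp K * exp (d * x\<^sup>2)"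
    by (meson exp_ge_zero mult_right_mono order_trans)
qed

text \<open>The derivative of the holomorphic part is the circle mean of \<open>\<phi>(z + \<zeta>) \<zeta>\<^sup>-\<^sup>1\<close>, to which the
  antiholomorphic part does not contribute.\<close>

lemma holomorphic_part_growth:
  assumes g: "g holomorphic_on UNIV" and h: "h holomorphic_on UNIV"
    and growth: "\<And>z. norm (g z + cnj (h z)) \<le> C * exp (c * (norm z)\<^sup>2)"
    and c: "0 \<le> c" "c < d"
  obtains D where "\<And>z. norm (g z) \<le> D * exp (d * (norm z)\<^sup>2)"
proof -
  have C: "C \<ge> 0" using growth[of 0] by (simp add: order_trans[OF norm_ge_zero])
  define B where "B x = C * exp (c * (x + 1)\<^sup>2)" for x
  have B_mono: "B x \<le> B y" if "x \<le> y" "0 \<le> x" for x y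
    unfolding B_def using that c C by (intro mult_left_mono) (auto intro!: mult_left_mono power_mono)
  have cg: "continuous_on A g" and ch: "continuous_on A h" for A
    using g h holomorphic_on_imp_continuous_on holomorphic_on_subset by blast+
  have deriv_le: "norm (deriv g z) \<le> B (norm z)" for z
  proof -
    \<comment> \<open>The difference quotient of \<open>g\<close> at z with its singularity removed:
      it is entire and its value at 0 is the derivative.\<close>
    define q where "q = (\<lambda>w. if w = 0 then deriv (\<lambda>w. g (z + w)) 0 else (g (z + w) - g (z + 0)) / (w - 0))"
    have hs: "(\<lambda>w. g (z + w)) holomorphic_on UNIV" "(\<lambda>w. h (z + w)) holomorphic_on UNIV"
      using g h by (auto intro!: holomorphic_on_compose_gen[unfolded o_def, of "\<lambda>w. z + w" UNIV] holomorphic_intros)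
    have q: "q holomorphic_on UNIV"
      unfolding q_def using hs(1) by (intro pole_lemma) auto
    \<comment> \<open>On the unit circle 1/e = cnj e, so the \<open>h\<close> term of the mean is
      the conjugate of an entire function that vanishes at 0.\<close>
    have ih: "(\<lambda>w. h (z + w) * w) holomorphic_on UNIV" 
      using hs by (intro holomorphic_intros)
    define e where "e t = cis (2 * pi * t)" for t
    have ce: "continuous_on A e" for A unfolding e_def by (intro continuous_intros)
    have [simp]: "norm (e t) = 1" for t by (simp add: e_def)
    have inv: "1 / e t = cnj (e t)" for t by (simp add: e_def cis_cnj divide_inverse)
    have "deriv g z = q 0"
      using deriv_shift_0[of g z] by (simp add: q_def o_def)
    also have "\<dots> = (\<integral>t. q (e t) \<partial>unit_interval)"
      using circle_mean_entire[OF q] by (simp add: e_def)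
    also have "\<dots> = (\<integral>t. (g (z + e t) + cnj (h (z + e t))) * cnj (e t)
        - cnj (h (z + e t) * e t) - g z * cnj (e t) \<partial>unit_interval)"
    proof (rule Bochner_Integration.integral_cong[OF refl])
      fix t
      have "e t \<noteq> 0" by (simp add: e_def)
      then have "q (e t) = (g (z + e t) - g z) * (1 / e t)" by (simp add: q_def)
      then show "q (e t) = (g (z + e t) + cnj (h (z + e t))) * cnj (e t)
        - cnj (h (z + e t) * e t) - g z * cnj (e t)"
        by (simp add: inv algebra_simps)
    qed
    also have "\<dots> = (\<integral>t. (g (z + e t) + cnj (h (z + e t))) * cnj (e t) \<partial>unit_interval)
        - (\<integral>t. cnj (h (z + e t) * e t) \<partial>unit_interval) - (\<integral>t. g z * cnj (e t) \<partial>unit_interval)"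
    proof -
      have "integrable unit_interval (\<lambda>t. (g (z + e t) + cnj (h (z + e t))) * cnj (e t))"
        "integrable unit_interval (\<lambda>t. cnj (h (z + e t) * e t))"
        "integrable unit_interval (\<lambda>t. g z * cnj (e t))"
        by (intro integral_unit_interval continuous_intros
            continuous_on_compose2[OF cg[of UNIV]] continuous_on_compose2[OF ch[of UNIV]] ce; simp)+
      then show ?thesis by simp
    qed
    also have "(\<integral>t. cnj (h (z + e t) * e t) \<partial>unit_interval) = 0"
      using circle_mean_cnj_entire[OF ih] by (simp add: e_def)
    also have "(\<integral>t. g z * cnj (e t) \<partial>unit_interval) = 0"
      using circle_mean_cnj_entire[of "\<lambda>w. w"] by (simp add: e_def)
    also have "norm ((\<integral>t. (g (z + e t) + cnj (h (z + e t))) * cnj (e t) \<partial>unit_interval) - 0 - 0) \<le> B (norm z)"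
      unfolding e_def diff_0_right
    proof (rule norm_circle_mean_le)
      show "continuous_on UNIV (\<lambda>x. (g (z + x) + cnj (h (z + x))) * cnj x)"
        by (intro continuous_intros continuous_on_compose2[OF cg[of UNIV]] continuous_on_compose2[OF ch[of UNIV]]) auto
      fix w :: complex assume w: "norm w = 1"
      have "norm ((g (z + w) + cnj (h (z + w))) * cnj w) \<le> C * exp (c * (norm (z + w))\<^sup>2)"
        using growth[of "z + w"] w by (simp add: norm_mult)
      also have "\<dots> \<le> B (norm z)"
        unfolding B_def using norm_triangle_ineq[of z w] w c C
        by (intro mult_left_mono) (auto intro!: mult_left_mono power_mono)
      finally show "norm ((g (z + w) + cnj (h (z + w))) * cnj w) \<le> B (norm z)" .
    qed
    finally show ?thesis .
  qed
  obtain D where D: "D > 0" "\<And>x. 0 \<le> x \<Longrightarrow> x * exp (c * (x + 1)\<^sup>2) \<le> D * exp (d * x\<^sup>2)"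
    using mult_exp_shifted_square_bound[OF c] by blast
  show ?thesis
  proof (rule that[of "norm (g 0) + C * D"])
    fix z
    \<comment> \<open>Integrating the derivative bound costs a factor \<open>norm z\<close>, and the
      unit circles shift the argument of \<open>B\<close> by 1; the gap between c and d absorbs
      both.\<close>
    have "norm (g z - g 0) \<le> B (norm z) * norm (z - 0)"
    proof (rule field_differentiable_bound[of "cball 0 (norm z)" g "deriv g"])
      show "(g has_field_derivative deriv g w) (at w within cball 0 (norm z))" for w
        using holomorphic_derivI[OF g open_UNIV UNIV_I] by (rule has_field_derivative_at_within)
      show "norm (deriv g w) \<le> B (norm z)" if "w \<in> cball 0 (norm z)" for w
        using deriv_le[of w] B_mono[of "norm w" "norm z"] that by simp
    qed auto
    also have "\<dots> = C * (norm z * exp (c * (norm z + 1)\<^sup>2))" by (simp add: B_def)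
    also have "\<dots> \<le> C * (D * exp (d * (norm z)\<^sup>2))"
      using C by (intro mult_left_mono D) auto
    finally have 1: "norm (g z - g 0) \<le> C * D * exp (d * (norm z)\<^sup>2)" by simp
    have "norm (g 0) \<le> norm (g 0) * exp (d * (norm z)\<^sup>2)"
      using mult_left_mono[of 1 "exp (d * (norm z)\<^sup>2)" "norm (g 0)"] c by simp
    then show "norm (g z) \<le> (norm (g 0) + C * D) * exp (d * (norm z)\<^sup>2)"
      using 1 norm_triangle_ineq2[of "g z" "g 0"] by (simp add: distrib_right)
  qed
qed

section \<open>Complex lines and circle averages\<close>

text \<open>Each \<open>U c\<close> preserves Lebesgue measure, so the integral of \<open>Q\<close>
  composed with it does not depend on c; averaging over c and exchanging the integrals gives the
  claim. It is applied to scalar multiplication and to rotations of an orthogonal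
  complement.\<close>

lemma circle_average:
  fixes Q Q0 :: "'a::euclidean_space \<Rightarrow> complex" and U :: "complex \<Rightarrow> 'a \<Rightarrow> 'a"
  assumes Q: "integrable lborel Q"
    and U: "continuous_on UNIV (\<lambda>p. U (fst p) (snd p))"
    and lin: "\<And>c. norm c = 1 \<Longrightarrow> linear (U c)"
    and iso: "\<And>c z. norm c = 1 \<Longrightarrow> norm (U c z) = norm z"
    and mean: "\<And>z. (\<integral>t. Q (U (cis (2 * pi * t)) z) \<partial>unit_interval) = Q0 z"
  shows "(\<integral>z. Q z \<partial>lborel) = (\<integral>z. Q0 z \<partial>lborel)"
proof -
  interpret P: pair_sigma_finite unit_interval "lborel :: 'a measure" ..
  have [measurable]: "Q \<in> borel_measurable borel" using borel_measurable_integrable[OF Q] by simp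
  have inv: "distr lborel borel (U (cis (2 * pi * t))) = lborel" for t
    using lin iso by (intro lborel_distr_isometry) auto
  have Ut[measurable]: "U c \<in> borel_measurable borel" for c
    by (rule borel_measurable_continuous_onI, rule continuous_on_compose2[OF U, of UNIV "\<lambda>z. (c, z)", simplified])
       (intro continuous_intros)
  \<comment> \<open>Stated for an arbitrary outer function so that it covers both the norm, for
    Fubini's integrability condition, and the identity, for the value.\<close>
  have int: "integrable lborel (\<lambda>z. f (Q (U (cis (2 * pi * t)) z)))"
    "(\<integral>z. f (Q (U (cis (2 * pi * t)) z)) \<partial>lborel) = (\<integral>z. f (Q z) \<partial>lborel)"
    if "integrable lborel (\<lambda>z. f (Q z))" for f :: "complex \<Rightarrow> complex" and t
  proof -
    have m: "(\<lambda>z. f (Q z)) \<in> borel_measurable borel" using borel_measurable_integrable[OF that] by simp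
    show "integrable lborel (\<lambda>z. f (Q (U (cis (2 * pi * t)) z)))"
      using that integrable_distr_eq[of "U (cis (2 * pi * t))" lborel borel "\<lambda>z. f (Q z)"] m by (simp add: inv)
    show "(\<integral>z. f (Q (U (cis (2 * pi * t)) z)) \<partial>lborel) = (\<integral>z. f (Q z) \<partial>lborel)"
      using integral_distr[of "U (cis (2 * pi * t))" lborel borel "\<lambda>z. f (Q z)"] m by (simp add: inv)
  qed
  have "(\<lambda>p. U (cis (2 * pi * fst p)) (snd p)) \<in> borel_measurable (borel :: (real \<times> 'a) measure)"
    by (rule borel_measurable_continuous_onI,
        rule continuous_on_compose2[OF U, of UNIV "\<lambda>p. (cis (2 * pi * fst p), snd p)", simplified])
       (intro continuous_intros)
  then have "(\<lambda>p. Q (U (cis (2 * pi * fst p)) (snd p))) \<in> borel_measurable (borel \<Otimes>\<^sub>M borel)"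
    by (simp add: borel_prod)
  moreover have "(\<lambda>p. (fst p, snd p)) \<in> measurable (unit_interval \<Otimes>\<^sub>M (lborel :: 'a measure)) (borel \<Otimes>\<^sub>M borel)"
    using measurable_compose[OF measurable_fst measurable_unit_interval[OF measurable_ident]]
    by (intro measurable_Pair) (auto simp: id_def)
  ultimately have "(\<lambda>p. Q (U (cis (2 * pi * fst (fst p, snd p))) (snd (fst p, snd p))))
      \<in> borel_measurable (unit_interval \<Otimes>\<^sub>M (lborel :: 'a measure))"
    by (rule measurable_compose[rotated])
  then have meas: "(\<lambda>(t, z). Q (U (cis (2 * pi * t)) z)) \<in> borel_measurable (unit_interval \<Otimes>\<^sub>M lborel)"
    by (simp add: case_prod_unfold)
  have "integrable (unit_interval \<Otimes>\<^sub>M lborel) (\<lambda>(t, z). Q (U (cis (2 * pi * t)) z))"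
  proof (rule P.Fubini_integrable[OF meas])
    have "complex_of_real (\<integral>z. norm (Q (U (cis (2 * pi * t)) z)) \<partial>lborel) = complex_of_real (\<integral>z. norm (Q z) \<partial>lborel)" for t
      using int(2)[of "\<lambda>z. of_real (norm z)" t] Q by simp
    then show "integrable unit_interval (\<lambda>t. \<integral>z. norm (case (t, z) of (t, z) \<Rightarrow> Q (U (cis (2 * pi * t)) z)) \<partial>lborel)"
      by simp
    show "AE t in unit_interval. integrable lborel (\<lambda>z. case (t, z) of (t, z) \<Rightarrow> Q (U (cis (2 * pi * t)) z))"
      using int(1)[of "\<lambda>z. z"] Q by simp
  qed
  then have "(\<integral>z. (\<integral>t. Q (U (cis (2 * pi * t)) z) \<partial>unit_interval) \<partial>lborel)
      = (\<integral>t. (\<integral>z. Q (U (cis (2 * pi * t)) z) \<partial>lborel) \<partial>unit_interval)"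
    by (rule P.Fubini_integral)
  also have "\<dots> = (\<integral>z. Q z \<partial>lborel)"
    using int(2)[of "\<lambda>z. z"] Q by (simp add: unit_interval.prob_space)
  finally show ?thesis by (simp add: mean)
qed

section \<open>The Hermitian form on complex n-space\<close>

definition herm :: "complex ^ 'n \<Rightarrow> complex ^ 'n \<Rightarrow> complex" where
  "herm z a = (\<Sum>k\<in>UNIV. z $ k * cnj (a $ k))"

lemma herm_add_left: "herm (z + w) a = herm z a + herm w a"
  by (simp add: herm_def algebra_simps sum.distrib)

lemma herm_diff_left: "herm (z - w) a = herm z a - herm w a"
  by (simp add: herm_def algebra_simps sum_subtractf)

lemma herm_scale_left: "herm (c *s z) a = c * herm z a"
  by (simp add: herm_def sum_distrib_left mult_ac)

lemma herm_scale_right: "herm z (c *s a) = cnj c * herm z a"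
  by (simp add: herm_def sum_distrib_left mult_ac)

lemma cnj_herm: "cnj (herm z a) = herm a z"
  by (simp add: herm_def mult.commute)

lemma Re_herm: "Re (herm z a) = z \<bullet> a"
  by (simp add: herm_def inner_vec_def inner_complex_def)

lemma herm_self: "herm z z = of_real ((norm z)\<^sup>2)"
  by (simp add: complex_eq_iff Re_herm power2_norm_eq_inner) (simp add: herm_def mult.commute)

lemma norm_smult_complex: "norm (c *s z) = norm c * norm (z :: complex ^ 'n)"
proof -
  have "complex_of_real ((norm (c *s z))\<^sup>2) = of_real ((norm c * norm z)\<^sup>2)"
    unfolding herm_self[symmetric] herm_scale_left herm_scale_right
    by (simp only: power_mult_distrib of_real_mult complex_norm_square herm_self mult_ac)
  then show ?thesis
    by (metis of_real_eq_iff norm_ge_zero mult_nonneg_nonneg power2_eq_imp_eq)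
qed

lemma norm_herm_le: "norm (herm z a) \<le> norm z * norm a"
proof -
  \<comment> \<open>This factor rotates the product onto its absolute value, after which the real
    Cauchy-Schwarz inequality applies. As \<open>sgn 0 = 0\<close>, only
    \<open>norm c \<le> 1\<close> holds in general.\<close>
  define c where "c = cnj (sgn (herm z a))"
  have "norm c \<le> 1" by (simp add: c_def norm_sgn)
  have "cnj (sgn x) * x = of_real (norm x)" for x :: complex
  proof -
    have "cnj (sgn x) * x = of_real ((norm x)\<^sup>2) / of_real (norm x)"
      unfolding complex_norm_square by (simp add: sgn_eq)
    then show ?thesis by (simp add: power2_eq_square)
  qed
  then have "norm (herm z a) = Re (herm (c *s z) a)"
    by (simp add: herm_scale_left c_def)
  also have "\<dots> \<le> norm (c *s z) * norm a" unfolding Re_herm by (rule norm_cauchy_schwarz)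
  also have "\<dots> \<le> norm z * norm a"
    using \<open>norm c \<le> 1\<close> by (simp add: norm_smult_complex mult_left_le_one_le mult_right_mono)
  finally show ?thesis .
qed

lemma continuous_on_smult_vec [continuous_intros]:
  fixes x :: "'b::topological_space \<Rightarrow> complex ^ 'n"
  assumes "continuous_on S c" "continuous_on S x"
  shows "continuous_on S (\<lambda>t. c t *s x t)"
  unfolding vector_scalar_mult_def
  by (intro continuous_on_vec_lambda continuous_intros assms)

lemma continuous_on_herm [continuous_intros]:
  fixes x :: "'b::topological_space \<Rightarrow> complex ^ 'n"
  assumes "continuous_on S x" "continuous_on S y"
  shows "continuous_on S (\<lambda>t. herm (x t) (y t))"
  unfolding herm_def by (intro continuous_intros assms)

section \<open>Pluriharmonic functions along complex lines\<close>

lemma linear_smult_vec: "linear (\<lambda>z :: complex ^ 'n. c *s z)"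
  by (rule linearI) (simp_all add: vec_eq_iff algebra_simps)

lemma linear_smult_vec_left: "linear (\<lambda>c. c *s (w :: complex ^ 'n))"
  by (rule linearI) (simp_all add: vec_eq_iff algebra_simps)

text \<open>Connects differentials in arbitrary directions with the Wirtinger operators, which see
  only the coordinate directions.\<close>

lemma linear_axis_expansion:
  fixes T :: "complex ^ 'n \<Rightarrow> complex"
  assumes "linear T"
  shows "T v = (\<Sum>j\<in>UNIV. of_real (Re (v $ j)) * T (axis j 1) + of_real (Im (v $ j)) * T (axis j \<i>))"
proof -
  have v: "v = (\<Sum>j\<in>UNIV. Re (v $ j) *\<^sub>R axis j 1 + Im (v $ j) *\<^sub>R axis j \<i>)"
    by (auto simp: vec_eq_iff axis_def complex_eq_iff if_distrib[where f=Re] if_distrib[where f=Im]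
        mult_delta_right cong: if_cong)
  show ?thesis
    by (subst v) (simp add: linear_sum[OF assms] linear_add[OF assms] linear_scale[OF assms]
        scaleR_conv_of_real[where 'a = complex])
qed

text \<open>Along the line, the zbar-derivative of f is a combination of the functions
  \<open>d_zbar k f\<close> with constant coefficients. Pluriharmonicity makes these
  antiholomorphic, so the one-variable splitting applies.\<close>

lemma pluriharmonic_line:
  fixes f :: "complex ^ 'n \<Rightarrow> complex"
  assumes f: "pluriharmonic f"
  obtains g h where "g holomorphic_on UNIV" "h holomorphic_on UNIV"
    "\<And>l. f (z + l *s w) = g l + cnj (h l)"
proof -
  define T where "T x = frechet_derivative f (at x)" for x
  have T: "(f has_derivative T x) (at x)" for x
    using f by (simp add: T_def pluriharmonic_def C2_fun_def C1_fun_def frechet_derivative_works)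
  have linT: "linear (T x)" for x using T by (rule has_derivative_linear)
  define D where "D k x = frechet_derivative (d_zbar k f) (at x)" for k x
  have D: "(d_zbar k f has_derivative D k x) (at x)" for k x
  proof -
    have "(\<lambda>z. frechet_derivative f (at z) v) differentiable (at x)" for v
      using f by (simp add: pluriharmonic_def C2_fun_def C1_fun_def)
    then have "d_zbar k f differentiable (at x)"
      unfolding d_zbar_def[abs_def] divide_inverse by (intro derivative_intros) auto
    then show ?thesis by (simp add: D_def frechet_derivative_works)
  qed
  have linD: "linear (D k x)" for k x using D by (rule has_derivative_linear)
  \<comment> \<open>The conjugate Cauchy-Riemann equations in each coordinate; summed over the
    coordinates they make the differential of \<open>d_zbar k f\<close> complex-antilinear.\<close>
  have CR: "D k x (axis j \<i>) = - \<i> * D k x (axis j 1)" for j k x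
  proof -
    have "d_z j (d_zbar k f) x = 0" using f by (simp add: pluriharmonic_def)
    then have "D k x (axis j 1) = \<i> * D k x (axis j \<i>)" by (simp add: d_z_def D_def)
    then show ?thesis by simp
  qed
  have antilin: "D k x (\<i> *s v) = - \<i> * D k x v" for k x v
    unfolding linear_axis_expansion[OF linD, of _ _ "\<i> *s v"] linear_axis_expansion[OF linD, of _ _ v] CR
      sum_distrib_left
    by (rule sum.cong[OF refl]) (simp add: algebra_simps)
  have line: "((\<lambda>l. z + l *s w) has_derivative (\<lambda>l. l *s w)) (at l)" for l
    using linear_imp_has_derivative[OF linear_smult_vec_left] 
    by (auto intro!: derivative_eq_intros)
  \<comment> \<open>By the chain rule this is the zbar-derivative of f along the line, as
    \<open>E_eq\<close> confirms.\<close>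
  define E where "E l = (\<Sum>k\<in>UNIV. cnj (w $ k) * d_zbar k f (z + l *s w))" for l
  have E_eq: "(T x (1 *s w) + \<i> * T x (\<i> *s w)) / 2 = (\<Sum>k\<in>UNIV. cnj (w $ k) * d_zbar k f x)" for x
  proof -
    have "T x (1 *s w) + \<i> * T x (\<i> *s w)
        = (\<Sum>k\<in>UNIV. cnj (w $ k) * (T x (axis k 1) + \<i> * T x (axis k \<i>)))"
      unfolding linear_axis_expansion[OF linT, of _ "1 *s w"] linear_axis_expansion[OF linT, of _ "\<i> *s w"]
        sum_distrib_left sum.distrib[symmetric]
    proof (rule sum.cong[OF refl])
      fix k
      have w: "cnj (w $ k) = of_real (Re (w $ k)) - \<i> * of_real (Im (w $ k))"
        by (simp add: complex_eq_iff)
      show "of_real (Re ((1 *s w) $ k)) * T x (axis k 1) + of_real (Im ((1 *s w) $ k)) * T x (axis k \<i>)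
          + \<i> * (of_real (Re ((\<i> *s w) $ k)) * T x (axis k 1) + of_real (Im ((\<i> *s w) $ k)) * T x (axis k \<i>))
          = cnj (w $ k) * (T x (axis k 1) + \<i> * T x (axis k \<i>))"
        unfolding w by (simp add: algebra_simps)
    qed
    then show ?thesis by (simp add: d_zbar_def T_def sum_divide_distrib)
  qed
  have hol: "(\<lambda>l. cnj (E l)) holomorphic_on UNIV"
  proof -
    have "((\<lambda>l. cnj (E l)) has_field_derivative
        (\<lambda>v. cnj (\<Sum>k\<in>UNIV. cnj (w $ k) * D k (z + l *s w) (v *s w))) 1) (at l)" for l
    proof (rule has_field_derivative_Cauchy_Riemann)
      show "((\<lambda>l. cnj (E l)) has_derivative
        (\<lambda>v. cnj (\<Sum>k\<in>UNIV. cnj (w $ k) * D k (z + l *s w) (v *s w)))) (at l)"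
        unfolding E_def
        by (intro has_derivative_cnj has_derivative_sum has_derivative_mult_right
            has_derivative_compose[OF line D])
      show "cnj (\<Sum>k\<in>UNIV. cnj (w $ k) * D k (z + l *s w) (\<i> *s w))
        = \<i> * cnj (\<Sum>k\<in>UNIV. cnj (w $ k) * D k (z + l *s w) (1 *s w))"
        by (simp add: antilin sum_distrib_left mult_ac)
    qed
    then show ?thesis by (auto simp: holomorphic_on_def field_differentiable_def)
  qed
  show ?thesis
  proof (rule holomorphic_plus_antiholomorphic[of "\<lambda>l. f (z + l *s w)" "\<lambda>l v. T (z + l *s w) (v *s w)"])
    show "((\<lambda>l. f (z + l *s w)) has_derivative (\<lambda>v. T (z + l *s w) (v *s w))) (at l)" for l
      by (rule has_derivative_compose[OF line T])
    show "(\<lambda>l. cnj ((T (z + l *s w) (1 *s w) + \<i> * T (z + l *s w) (\<i> *s w)) / 2)) holomorphic_on UNIV"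
      using hol unfolding E_eq E_def .
  qed (rule that)
qed

lemma pluriharmonic_circle_mean:
  assumes "pluriharmonic f"
  shows "(\<integral>t. f (z + cis (2 * pi * t) *s w) \<partial>unit_interval) = f z"
proof -
  obtain g h where gh: "g holomorphic_on UNIV" "h holomorphic_on UNIV"
    "\<And>l. f (z + l *s w) = g l + cnj (h l)"
    using pluriharmonic_line[OF assms] by blast
  have c: "continuous_on {0..1} (\<lambda>t. g (cis (2 * pi * t)))" "continuous_on {0..1} (\<lambda>t. cnj (h (cis (2 * pi * t))))"
    by (intro continuous_on_cnj continuous_on_compose2[OF holomorphic_on_imp_continuous_on[OF gh(1)]]
        continuous_on_compose2[OF holomorphic_on_imp_continuous_on[OF gh(2)]] continuous_intros; simp)+
  have "(\<integral>t. f (z + cis (2 * pi * t) *s w) \<partial>unit_interval) = g 0 + cnj (h 0)"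
    using circle_mean_entire[OF gh(1)] circle_mean_cnj_entire[OF gh(2)]
      integral_unit_interval(1)[OF c(1)] integral_unit_interval(1)[OF c(2)]
    by (simp add: gh(3))
  then show ?thesis using gh(3)[of 0] by simp
qed

lemma pluriharmonic_continuous: "pluriharmonic f \<Longrightarrow> continuous_on A f"
  by (auto simp: pluriharmonic_def C2_fun_def C1_fun_def
      intro!: continuous_at_imp_continuous_on differentiable_imp_continuous_within)

section \<open>Growth of functions in \<open>PH_space\<close>\<close>

lemma lborel_integrable_shift:
  fixes f :: "'a::euclidean_space \<Rightarrow> 'b::{banach, second_countable_topology}"
  assumes "integrable lborel f"
  shows "integrable lborel (\<lambda>x. f (a + x))"
proof -
  have "integrable (distr lborel borel ((+) a)) f"
    using assms by (simp add: lborel_distr_plus)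
  moreover have "f \<in> borel_measurable borel"
    using borel_measurable_integrable[OF assms] by simp
  ultimately show ?thesis
    using integrable_distr_eq[of "(+) a" lborel borel f] by simp
qed

lemma integrable_gaussian:
  fixes a :: "'a::euclidean_space"
  assumes "c > 0"
  shows "integrable lborel (\<lambda>x. exp (- c * (norm (x - a))\<^sup>2))"
  using nn_integral_gaussian_finite[OF assms, of a] by (intro integrableI_nonneg) auto

text \<open>The linear term in the exponent makes room for kernels such as exp(c * herm z a) and for
  translations of the argument.\<close>

lemma integrable_gaussian_growth:
  fixes f :: "'a::euclidean_space \<Rightarrow> complex"
  assumes f: "continuous_on UNIV f"
    and growth: "\<And>z. norm (f z) \<le> C * exp (d * (norm z)\<^sup>2 + b * norm z)"
    and d: "d < c"
  shows "integrable lborel (\<lambda>z. f z * of_real (exp (- c * (norm z)\<^sup>2)))"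
proof (rule Bochner_Integration.integrable_bound)
  \<comment> \<open>Half of the gap c - d absorbs the linear term by completing the square; the
    other half remains as the Gaussian majorant.\<close>
  define \<epsilon> where "\<epsilon> = (c - d) / 2"
  have \<epsilon>: "\<epsilon> > 0" "d = c - 2 * \<epsilon>" using d by (auto simp: \<epsilon>_def field_simps)
  have C: "C \<ge> 0" using growth[of 0] by (simp add: order_trans[OF norm_ge_zero])
  show "integrable lborel (\<lambda>z::'a. C * exp (b\<^sup>2 / (4 * \<epsilon>)) * exp (- \<epsilon> * (norm z)\<^sup>2))"
    using integrable_gaussian[OF \<epsilon>(1), of "0 :: 'a"] by simp
  show "(\<lambda>z. f z * of_real (exp (- c * (norm z)\<^sup>2))) \<in> borel_measurable lborel"
    by (simp, rule borel_measurable_continuous_onI) (intro continuous_intros f)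
  show "AE z in lborel. norm (f z * of_real (exp (- c * (norm z)\<^sup>2)))
      \<le> norm (C * exp (b\<^sup>2 / (4 * \<epsilon>)) * exp (- \<epsilon> * (norm z)\<^sup>2))"
  proof (rule AE_I2)
    fix z :: 'a
    define x where "x = norm z"
    have "0 \<le> (2 * \<epsilon> * x - b)\<^sup>2 / (4 * \<epsilon>)" using \<epsilon> by simp
    also have "\<dots> = (4 * \<epsilon> * (\<epsilon> * x\<^sup>2 - b * x) + b\<^sup>2) / (4 * \<epsilon>)"
      by (simp add: power2_eq_square algebra_simps)
    also have "\<dots> = \<epsilon> * x\<^sup>2 - b * x + b\<^sup>2 / (4 * \<epsilon>)"
      using \<epsilon> by (simp add: add_divide_distrib)
    finally have *: "d * x\<^sup>2 + b * x + - c * x\<^sup>2 \<le> b\<^sup>2 / (4 * \<epsilon>) + - \<epsilon> * x\<^sup>2"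
      by (simp add: \<epsilon>(2) algebra_simps)
    have "norm (f z * of_real (exp (- c * (norm z)\<^sup>2))) \<le> C * exp (d * x\<^sup>2 + b * x) * exp (- c * x\<^sup>2)"
      using growth[of z] by (simp add: norm_mult x_def mult_right_mono)
    also have "\<dots> = C * exp (d * x\<^sup>2 + b * x + - c * x\<^sup>2)"
      by (simp only: exp_add mult.assoc)
    also have "\<dots> \<le> C * exp (b\<^sup>2 / (4 * \<epsilon>) + - \<epsilon> * x\<^sup>2)"
      using * C by (intro mult_left_mono) auto
    also have "\<dots> = C * exp (b\<^sup>2 / (4 * \<epsilon>)) * exp (- \<epsilon> * x\<^sup>2)"
      by (simp only: exp_add mult.assoc)
    finally show "norm (f z * of_real (exp (- c * (norm z)\<^sup>2)))
      \<le> norm (C * exp (b\<^sup>2 / (4 * \<epsilon>)) * exp (- \<epsilon> * (norm z)\<^sup>2))"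
      using C by (simp add: x_def)
  qed
qed

text \<open>Unit scalars preserve the ball centred at 0, so the mean value property on circles turns
  the integral of f over the ball around a into the volume times f(a).\<close>

lemma pluriharmonic_ball_mean:
  fixes f :: "complex ^ 'n \<Rightarrow> complex"
  assumes f: "pluriharmonic f"
  shows "measure lborel (cball (0 :: complex ^ 'n) 1) * norm (f a)
      \<le> (\<integral>w. indicator (cball 0 1) w * norm (f (a + w)) \<partial>lborel)"
proof -
  let ?B = "cball (0 :: complex ^ 'n) 1"
  have cf: "continuous_on UNIV (\<lambda>w. f (a + w))"
    by (intro continuous_on_compose2[OF pluriharmonic_continuous[OF f, of UNIV]] continuous_intros) auto
  have int: "integrable lborel (\<lambda>w. indicator ?B w *\<^sub>R f (a + w))"
    by (rule borel_integrable_compact) (auto intro: continuous_on_subset[OF cf])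
  have "(\<integral>w. indicator ?B w *\<^sub>R f (a + w) \<partial>lborel) = (\<integral>w. indicator ?B w *\<^sub>R f a \<partial>lborel)"
  proof (rule circle_average[OF int, of "(*s)"])
    show "continuous_on UNIV (\<lambda>p. fst p *s (snd p :: complex ^ 'n))" by (intro continuous_intros)
    fix w :: "complex ^ 'n"
    have "indicator ?B (cis (2 * pi * t) *s w) = (indicator ?B w :: real)" for t
      by (simp add: indicator_def norm_smult_complex)
    then show "(\<integral>t. indicator ?B (cis (2 * pi * t) *s w) *\<^sub>R f (a + cis (2 * pi * t) *s w) \<partial>unit_interval)
        = indicator ?B w *\<^sub>R f a"
      by (simp add: pluriharmonic_circle_mean[OF f])
  qed (auto simp: linear_smult_vec norm_smult_complex)
  also have "\<dots> = measure lborel ?B *\<^sub>R f a"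
    using integrable_real_indicator[OF _ emeasure_lborel_cball_finite, of "0 :: complex ^ 'n" 1]
    by (subst integral_scaleR_left) auto
  finally have "measure lborel ?B * norm (f a) = norm (\<integral>w. indicator ?B w *\<^sub>R f (a + w) \<partial>lborel)"
    by simp
  also have "\<dots> \<le> (\<integral>w. norm (indicator ?B w *\<^sub>R f (a + w)) \<partial>lborel)"
    by (rule integral_norm_bound)
  finally show ?thesis by simp
qed

definition weighted :: "real \<Rightarrow> (complex ^ 'n \<Rightarrow> complex) \<Rightarrow> complex ^ 'n \<Rightarrow> real" where
  "weighted \<alpha> f z = cmod (f z * of_real (exp (- (norm z)\<^sup>2 / (2 * \<alpha>))))"

lemma weighted_nonneg: "0 \<le> weighted \<alpha> f z"
  by (simp add: weighted_def)

lemma norm_eq_weighted: "norm (f z) = weighted \<alpha> f z * exp ((norm z)\<^sup>2 / (2 * \<alpha>))"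
  by (simp add: weighted_def norm_mult mult.assoc flip: exp_add)

lemma weighted_measurable [measurable]:
  "continuous_on UNIV f \<Longrightarrow> weighted \<alpha> f \<in> borel_measurable borel"
  unfolding weighted_def divide_inverse
  by (rule borel_measurable_continuous_onI) (intro continuous_intros)

lemma PH_space_pluriharmonic: "f \<in> PH_space p \<alpha> \<Longrightarrow> pluriharmonic f"
  by (simp add: PH_space_def)

lemma weighted_integral_lborel:
  "weighted_integral p \<alpha> lebesgue f = (\<integral>\<^sup>+z. ennreal (weighted \<alpha> f z powr p) \<partial>lborel)"
  by (simp add: weighted_integral_def weighted_def nn_integral_completion)

lemma PH_space_integrable:
  assumes "f \<in> PH_space p \<alpha>"
  shows "integrable lborel (\<lambda>z. weighted \<alpha> f z powr p)"
proof (rule integrableI_nonneg)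
  have "continuous_on UNIV f"
    using assms by (intro pluriharmonic_continuous PH_space_pluriharmonic)
  then show "(\<lambda>z. weighted \<alpha> f z powr p) \<in> borel_measurable lborel" by simp
  show "(\<integral>\<^sup>+z. ennreal (weighted \<alpha> f z powr p) \<partial>lborel) < \<infinity>"
    using assms by (simp add: PH_space_def Lp_space_def weighted_integral_lborel)
qed simp

text \<open>Takes the place of Hoelder's inequality where only finiteness matters.\<close>

lemma le_one_plus_powr:
  fixes x p :: real
  assumes "0 \<le> x" "1 \<le> p"
  shows "x \<le> 1 + x powr p"
proof (cases "x \<le> 1")
  case False
  then have "x powr 1 \<le> x powr p" using assms by (intro powr_mono) auto
  then show ?thesis using False by simp
qed (use powr_ge_zero[of x p] in linarith)

text \<open>The mean over the unit ball around z is controlled by the weighted L^p integral, at the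
  price of the weight at distance \<open>norm z + 1\<close>. The coefficient 5/8 exceeds 1/2 to
  absorb the linear term of (|z| + 1)^2 and is below 1 to keep the reproducing integral
  convergent.\<close>

lemma PH_space_growth:
  fixes f :: "complex ^ 'n \<Rightarrow> complex"
  assumes f: "f \<in> PH_space p \<alpha>" and p: "p \<ge> 1" and \<alpha>: "\<alpha> > 0"
  obtains C where "\<And>z. norm (f z) \<le> C * exp (5 / (8 * \<alpha>) * (norm z)\<^sup>2)"
proof -
  let ?B = "cball (0 :: complex ^ 'n) 1"
  define V where "V = measure lborel ?B"
  have V: "V > 0" unfolding V_def by (rule content_cball_pos) simp
  define I where "I = (\<integral>z. weighted \<alpha> f z powr p \<partial>lborel)"
  have ph: "pluriharmonic f" using f by (rule PH_space_pluriharmonic)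
  have cf: "continuous_on A f" for A using ph by (rule pluriharmonic_continuous)
  have int: "integrable lborel (\<lambda>w. weighted \<alpha> f (a + w) powr p)" for a
    by (rule lborel_integrable_shift[OF PH_space_integrable[OF f]])
  have intB: "integrable lborel (indicator ?B :: complex ^ 'n \<Rightarrow> real)"
    by (rule integrable_real_indicator[OF _ emeasure_lborel_cball_finite]) simp
  have bound: "V * norm (f a) \<le> exp ((norm a + 1)\<^sup>2 / (2 * \<alpha>)) * (V + I)" for a
  proof -
    have "V * norm (f a) \<le> (\<integral>w. indicator ?B w * norm (f (a + w)) \<partial>lborel)"
      unfolding V_def by (rule pluriharmonic_ball_mean[OF ph])
    also have "\<dots> \<le> (\<integral>w. exp ((norm a + 1)\<^sup>2 / (2 * \<alpha>)) * (indicator ?B w + weighted \<alpha> f (a + w) powr p) \<partial>lborel)"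
    proof (rule integral_mono)
      have "continuous_on UNIV (\<lambda>w. norm (f (a + w)))"
        by (intro continuous_on_norm continuous_on_compose2[OF cf[of UNIV]] continuous_intros) auto
      then have "integrable lborel (\<lambda>w. indicator ?B w *\<^sub>R norm (f (a + w)))"
        by (intro borel_integrable_compact) (auto intro: continuous_on_subset)
      then show "integrable lborel (\<lambda>w. indicator ?B w * norm (f (a + w)))" by simp
      show "integrable lborel (\<lambda>w. exp ((norm a + 1)\<^sup>2 / (2 * \<alpha>)) * (indicator ?B w + weighted \<alpha> f (a + w) powr p))"
        using int intB by simp
      fix w
      show "indicator ?B w * norm (f (a + w))
          \<le> exp ((norm a + 1)\<^sup>2 / (2 * \<alpha>)) * (indicator ?B w + weighted \<alpha> f (a + w) powr p)"
      proof (cases "w \<in> ?B")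
        case True
        have "norm (a + w) \<le> norm a + 1" using True norm_triangle_ineq[of a w] by simp
        then have "exp ((norm (a + w))\<^sup>2 / (2 * \<alpha>)) \<le> exp ((norm a + 1)\<^sup>2 / (2 * \<alpha>))"
          using \<alpha> by (simp add: divide_right_mono power_mono)
        moreover have "weighted \<alpha> f (a + w) \<le> 1 + weighted \<alpha> f (a + w) powr p"
          using p by (intro le_one_plus_powr weighted_nonneg)
        ultimately have "weighted \<alpha> f (a + w) * exp ((norm (a + w))\<^sup>2 / (2 * \<alpha>))
            \<le> (1 + weighted \<alpha> f (a + w) powr p) * exp ((norm a + 1)\<^sup>2 / (2 * \<alpha>))"
          by (intro mult_mono) auto
        then show ?thesis using True by (simp add: norm_eq_weighted[of f _ \<alpha>] mult.commute)
      qed simp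
    qed
    also have "\<dots> = exp ((norm a + 1)\<^sup>2 / (2 * \<alpha>)) * (V + I)"
    proof -
      have "(\<integral>w. weighted \<alpha> f (a + w) powr p \<partial>lborel) = I"
        unfolding I_def using weighted_measurable[OF cf[of UNIV], of \<alpha>]
        by (intro lborel_integral_shift) simp
      then show ?thesis using int intB by (simp add: V_def)
    qed
    finally show ?thesis .
  qed
  have "V + I \<ge> 0" unfolding I_def using V by (simp add: integral_nonneg)
  show ?thesis
  proof (rule that)
    fix z :: "complex ^ 'n"
    have "(norm z + 1)\<^sup>2 / (2 * \<alpha>) \<le> (5 / 8 * (norm z)\<^sup>2 + 5 / 2) / \<alpha>"
    proof -
      \<comment> \<open>Equivalent to (|z| - 4)^2 \<ge> 0, which is where 5/2 comes from.\<close>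
      have "(norm z + 1)\<^sup>2 / 2 \<le> 5 / 8 * (norm z)\<^sup>2 + 5 / 2"
        using zero_le_power2[of "norm z - 4"] by (simp add: power2_eq_square algebra_simps)
      from divide_right_mono[OF this, of \<alpha>] \<alpha> show ?thesis by simp
    qed
    also have "\<dots> = 5 / (2 * \<alpha>) + 5 / (8 * \<alpha>) * (norm z)\<^sup>2"
      using \<alpha> by (simp add: field_simps)
    finally have "exp ((norm z + 1)\<^sup>2 / (2 * \<alpha>)) \<le> exp (5 / (2 * \<alpha>)) * exp (5 / (8 * \<alpha>) * (norm z)\<^sup>2)"
      by (simp flip: exp_add)
    then have "V * norm (f z) \<le> exp (5 / (2 * \<alpha>)) * exp (5 / (8 * \<alpha>) * (norm z)\<^sup>2) * (V + I)"
      using bound[of z] \<open>V + I \<ge> 0\<close> by (meson mult_right_mono order_trans)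
    then show "norm (f z) \<le> (exp (5 / (2 * \<alpha>)) * (V + I) / V) * exp (5 / (8 * \<alpha>) * (norm z)\<^sup>2)"
      using V by (simp add: field_simps)
  qed
qed

section \<open>The reproducing formula\<close>

text \<open>The type argument carries the dimension of the space, which the result type
  \<open>real\<close> would not determine.\<close>

definition gauss_mass :: "'a::euclidean_space itself \<Rightarrow> real \<Rightarrow> real" where
  "gauss_mass _ c = (\<integral>z. exp (- c * (norm (z :: 'a))\<^sup>2) \<partial>lborel)"

lemma gauss_mass_pos:
  assumes "c > 0"
  shows "gauss_mass TYPE('a::euclidean_space) c > 0"
proof -
  let ?f = "\<lambda>z :: 'a. exp (- c * (norm z)\<^sup>2)"
  have "integrable lborel ?f" using integrable_gaussian[OF assms, of "0 :: 'a"] by simp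
  moreover have "\<not> (AE z in lborel. ?f z = 0)" 
    by (simp add: AE_iff_measurable[OF _ refl])
  ultimately have "(\<integral>z. ?f z \<partial>lborel) \<noteq> 0"
    by (subst integral_nonneg_eq_0_iff_AE) auto
  moreover have "(\<integral>z. ?f z \<partial>lborel) \<ge> 0" by (simp add: integral_nonneg)
  ultimately show ?thesis unfolding gauss_mass_def by linarith
qed

lemma gauss_mass_complex:
  "(\<integral>z. of_real (exp (- c * (norm (z :: complex ^ 'n))\<^sup>2)) \<partial>lborel) = complex_of_real (gauss_mass TYPE(complex ^ 'n) c)"
  by (simp add: gauss_mass_def)

text \<open>Rotation by unit scalars fixes the Gaussian and averages \<open>G\<close> to its value
  at the origin.\<close>

lemma integral_gaussian_entire:
  fixes G :: "complex ^ 'n \<Rightarrow> complex"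
  assumes G: "continuous_on UNIV G" "\<And>w. (\<lambda>l. G (l *s w)) holomorphic_on UNIV"
    and growth: "\<And>z. norm (G z) \<le> C * exp (d * (norm z)\<^sup>2 + b * norm z)" and d: "d < c"
  shows "(\<integral>z. G z * of_real (exp (- c * (norm z)\<^sup>2)) \<partial>lborel) = G 0 * gauss_mass TYPE(complex ^ 'n) c"
proof -
  have "(\<integral>z. G z * of_real (exp (- c * (norm z)\<^sup>2)) \<partial>lborel)
      = (\<integral>z. G 0 * of_real (exp (- c * (norm (z :: complex ^ 'n))\<^sup>2)) \<partial>lborel)"
  proof (rule circle_average[OF integrable_gaussian_growth[OF G(1) growth d], of "(*s)"])
    show "continuous_on UNIV (\<lambda>p. fst p *s (snd p :: complex ^ 'n))" by (intro continuous_intros)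
    show "(\<integral>t. G (cis (2 * pi * t) *s w) * of_real (exp (- c * (norm (cis (2 * pi * t) *s w))\<^sup>2)) \<partial>unit_interval)
        = G 0 * of_real (exp (- c * (norm w)\<^sup>2))" for w
      using circle_mean_entire[OF G(2)[of w]] by (simp add: norm_smult_complex)
  qed (auto simp: linear_smult_vec norm_smult_complex)
  then show ?thesis by (simp only: integral_mult_right_zero gauss_mass_complex)
qed

text \<open>In the first formula the whole product is holomorphic on lines, so its value at 0 is
  returned. In the second the kernel is antiholomorphic, but the translation z = a + w makes it
  holomorphic in w, and the value at w = 0 is returned.\<close>

lemma integral_gaussian_kernel:
  fixes G :: "complex ^ 'n \<Rightarrow> complex"
  assumes G: "continuous_on UNIV G" "\<And>z w. (\<lambda>l. G (z + l *s w)) holomorphic_on UNIV"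
    and growth: "\<And>z. norm (G z) \<le> C * exp (d * (norm z)\<^sup>2)" and d: "0 \<le> d" "d < c"
  shows "(\<integral>z. G z * exp (of_real c * herm z a) * of_real (exp (- c * (norm z)\<^sup>2)) \<partial>lborel)
      = G 0 * gauss_mass TYPE(complex ^ 'n) c" (is ?outer)
    and "(\<integral>z. G z * exp (of_real c * herm a z) * of_real (exp (- c * (norm z)\<^sup>2)) \<partial>lborel)
      = G a * gauss_mass TYPE(complex ^ 'n) c" (is ?inner)
proof -
  have C: "C \<ge> 0" using growth[of 0] by (simp add: order_trans[OF norm_ge_zero])
  have exp_le: "norm (exp (k * herm z a)) \<le> exp (norm k * norm a * norm z)" for k z
  proof -
    have "Re (k * herm z a) \<le> norm k * (norm z * norm a)"
      using complex_Re_le_cmod[of "k * herm z a"] mult_left_mono[OF norm_herm_le[of z a], of "norm k"]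
      by (simp add: norm_mult)
    then show ?thesis by (simp add: mult_ac)
  qed
  have hol_exp: "(\<lambda>l. exp (k * herm (x + l *s w) a)) holomorphic_on UNIV" for k x w
    unfolding herm_add_left herm_scale_left by (intro holomorphic_intros)
  have "(\<integral>z. G z * exp (of_real c * herm z a) * of_real (exp (- c * (norm z)\<^sup>2)) \<partial>lborel)
      = G 0 * exp (of_real c * herm 0 a) * gauss_mass TYPE(complex ^ 'n) c"
  proof (rule integral_gaussian_entire[where C = C and d = d and b = "c * norm a"])
    show "continuous_on UNIV (\<lambda>z. G z * exp (of_real c * herm z a))"
      by (intro continuous_intros G(1))
    show "(\<lambda>l. G (l *s w) * exp (of_real c * herm (l *s w) a)) holomorphic_on UNIV" for w
      using hol_exp[of "of_real c" 0 w] G(2)[of 0 w] by (intro holomorphic_on_mult) simp_all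
    show "norm (G z * exp (of_real c * herm z a)) \<le> C * exp (d * (norm z)\<^sup>2 + c * norm a * norm z)" for z
    proof -
      have "norm (G z * exp (of_real c * herm z a)) \<le> (C * exp (d * (norm z)\<^sup>2)) * exp (norm (of_real c :: complex) * norm a * norm z)"
        unfolding norm_mult using C by (intro mult_mono growth exp_le) auto
      then show ?thesis using d by (simp add: exp_add mult.assoc)
    qed
  qed (rule d)
  then show ?outer by (simp add: herm_def[of 0])
  let ?H = "\<lambda>w. G (a + w) * exp (- of_real c * herm w a)"
  have "(\<integral>z. G z * exp (of_real c * herm a z) * of_real (exp (- c * (norm z)\<^sup>2)) \<partial>lborel)
      = (\<integral>w. G (a + w) * exp (of_real c * herm a (a + w)) * of_real (exp (- c * (norm (a + w))\<^sup>2)) \<partial>lborel)"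
    by (rule lborel_integral_shift[symmetric], rule borel_measurable_continuous_onI)
       (intro continuous_intros G(1))
  also have "\<dots> = (\<integral>w. ?H w * of_real (exp (- c * (norm w)\<^sup>2)) \<partial>lborel)"
  proof (rule Bochner_Integration.integral_cong[OF refl])
    fix w
    \<comment> \<open>Expanding the square cancels <a,w>, the only antiholomorphic linear term, and
      leaves -<w,a>.\<close>
    have "herm a (a + w) - of_real ((norm (a + w))\<^sup>2) = - herm w a - of_real ((norm w)\<^sup>2)"
      unfolding herm_self[symmetric] by (simp add: herm_def algebra_simps sum.distrib)
    then have "of_real c * (herm a (a + w) - of_real ((norm (a + w))\<^sup>2))
        = of_real c * (- herm w a - of_real ((norm w)\<^sup>2))"
      by (simp only:)
    then have "of_real c * herm a (a + w) + of_real (- c * (norm (a + w))\<^sup>2)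
        = - of_real c * herm w a + of_real (- c * (norm w)\<^sup>2)"
      by (simp only: right_diff_distrib) simp
    then show "G (a + w) * exp (of_real c * herm a (a + w)) * of_real (exp (- c * (norm (a + w))\<^sup>2))
        = ?H w * of_real (exp (- c * (norm w)\<^sup>2))"
      unfolding exp_of_real[symmetric] mult.assoc exp_add[symmetric] by simp
  qed
  also have "\<dots> = ?H 0 * gauss_mass TYPE(complex ^ 'n) c"
  proof (rule integral_gaussian_entire[where C = "C * exp (d * (norm a)\<^sup>2)" and d = d and b = "2 * d * norm a + c * norm a"])
    show "continuous_on UNIV ?H"
      by (intro continuous_intros continuous_on_compose2[OF G(1)]) auto
    show "(\<lambda>l. G (a + l *s w) * exp (- of_real c * herm (l *s w) a)) holomorphic_on UNIV" for w
      using hol_exp[of "- of_real c" 0 w] by (intro holomorphic_on_mult G(2)) simp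
    show "norm (?H z) \<le> C * exp (d * (norm a)\<^sup>2) * exp (d * (norm z)\<^sup>2 + (2 * d * norm a + c * norm a) * norm z)" for z
    proof -
      have "norm (G (a + z)) \<le> C * exp (d * (norm a + norm z)\<^sup>2)"
        using growth[of "a + z"] norm_triangle_ineq[of a z] C d
        by (smt (verit) exp_le_cancel_iff mult_left_mono norm_ge_zero power_mono)
      moreover have "norm (exp (- of_real c * herm z a)) \<le> exp (c * norm a * norm z)"
        using exp_le[of "- of_real c" z] d by simp
      ultimately have "norm (?H z) \<le> (C * exp (d * (norm a + norm z)\<^sup>2)) * exp (c * norm a * norm z)"
        unfolding norm_mult using C by (intro mult_mono) auto
      also have "\<dots> = C * exp (d * (norm a + norm z)\<^sup>2 + c * norm a * norm z)"
        by (simp only: exp_add mult.assoc)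
      also have "d * (norm a + norm z)\<^sup>2 + c * norm a * norm z
          = d * (norm a)\<^sup>2 + (d * (norm z)\<^sup>2 + (2 * d * norm a + c * norm a) * norm z)"
        by (simp add: power2_eq_square algebra_simps)
      finally show ?thesis by (simp only: exp_add mult.assoc)
    qed
  qed (rule d)
  finally show ?inner by (simp add: herm_def)
qed

text \<open>Equal to 2 Re K - 1, where K = exp(c * herm a z) is the Fock kernel. Being real, it
  treats holomorphic and antiholomorphic parts alike.\<close>

definition ph_kernel :: "real \<Rightarrow> complex ^ 'n \<Rightarrow> complex ^ 'n \<Rightarrow> complex" where
  "ph_kernel c a z = exp (of_real c * herm z a) + exp (of_real c * herm a z) - 1"

lemma cnj_ph_kernel: "cnj (ph_kernel c a z) = ph_kernel c a z"
  by (simp add: ph_kernel_def exp_cnj cnj_herm)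

lemma norm_ph_kernel_le: "norm (ph_kernel c a z) \<le> 2 * exp (c * (z \<bullet> a)) + 1"
proof -
  have "norm (exp (of_real c * herm z a)) = exp (c * (z \<bullet> a))" 
    "norm (exp (of_real c * herm a z)) = exp (c * (z \<bullet> a))"
    by (simp_all add: Re_herm inner_commute)
  then show ?thesis
    unfolding ph_kernel_def
    using norm_triangle_ineq4[of "exp (of_real c * herm z a) + exp (of_real c * herm a z)" 1]
      norm_triangle_ineq[of "exp (of_real c * herm z a)" "exp (of_real c * herm a z)"]
    by (simp add: Re_herm inner_commute)
qed

lemma continuous_on_ph_kernel: "continuous_on A (ph_kernel c a)"
  unfolding ph_kernel_def[abs_def] by (intro continuous_intros)

lemma integrable_ph_kernel:
  fixes f :: "complex ^ 'n \<Rightarrow> complex"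
  assumes f: "continuous_on UNIV f"
    and growth: "\<And>z. norm (f z) \<le> C * exp (d * (norm z)\<^sup>2)" and d: "0 \<le> d" "d < c"
  shows "integrable lborel (\<lambda>z. f z * ph_kernel c a z * of_real (exp (- c * (norm z)\<^sup>2)))"
proof (rule integrable_gaussian_growth[where C = "3 * C" and d = d and b = "c * norm a"])
  have C: "C \<ge> 0" using growth[of 0] by (simp add: order_trans[OF norm_ge_zero])
  show "continuous_on UNIV (\<lambda>z. f z * ph_kernel c a z)"
    by (intro continuous_intros f continuous_on_ph_kernel)
  show "norm (f z * ph_kernel c a z) \<le> 3 * C * exp (d * (norm z)\<^sup>2 + c * norm a * norm z)" for z
  proof -
    have "c * (z \<bullet> a) \<le> c * (norm z * norm a)"
      using d by (intro mult_left_mono norm_cauchy_schwarz) auto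
    then have "exp (c * (z \<bullet> a)) \<le> exp (c * norm a * norm z)" by (simp add: mult_ac)
    moreover have "1 \<le> exp (c * norm a * norm z)" using d by simp
    ultimately have "norm (ph_kernel c a z) \<le> 3 * exp (c * norm a * norm z)"
      using norm_ph_kernel_le[of c a z] by linarith
    then have "norm (f z * ph_kernel c a z) \<le> (C * exp (d * (norm z)\<^sup>2)) * (3 * exp (c * norm a * norm z))"
      unfolding norm_mult using growth[of z] C by (intro mult_mono) auto
    then show ?thesis by (simp add: exp_add mult_ac)
  qed
qed (rule d)

text \<open>The three summands of the kernel contribute \<open>G 0\<close>, \<open>G a\<close> and
  \<open>- G 0\<close>; the constant 1 is the first exponential at a = 0.\<close>

lemma entire_ph_kernel:
  fixes G :: "complex ^ 'n \<Rightarrow> complex"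
  assumes G: "continuous_on UNIV G" "\<And>z w. (\<lambda>l. G (z + l *s w)) holomorphic_on UNIV"
    and growth: "\<And>z. norm (G z) \<le> C * exp (d * (norm z)\<^sup>2)" and d: "0 \<le> d" "d < c"
  shows "(\<integral>z. G z * ph_kernel c a z * of_real (exp (- c * (norm z)\<^sup>2)) \<partial>lborel)
    = G a * gauss_mass TYPE(complex ^ 'n) c"
proof -
  let ?E = "\<lambda>z :: complex ^ 'n. complex_of_real (exp (- c * (norm z)\<^sup>2))"
  let ?X = "\<lambda>z. G z * exp (of_real c * herm z a)"
  let ?Y = "\<lambda>z. G z * exp (of_real c * herm a z)"
  have C: "C \<ge> 0" using growth[of 0] by (simp add: order_trans[OF norm_ge_zero])
  have le: "exp (c * (z \<bullet> a)) \<le> exp (c * norm a * norm z)" for z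
  proof -
    have "c * (z \<bullet> a) \<le> c * (norm z * norm a)"
      using d by (intro mult_left_mono norm_cauchy_schwarz) auto
    then show ?thesis by (simp add: mult_ac)
  qed
  have growth_mult: "norm (G z * u) \<le> C * exp (d * (norm z)\<^sup>2 + c * norm a * norm z)"
    if "norm u \<le> exp (c * norm a * norm z)" for z u
  proof -
    have "norm (G z * u) \<le> (C * exp (d * (norm z)\<^sup>2)) * exp (c * norm a * norm z)"
      unfolding norm_mult using growth[of z] that C by (intro mult_mono) auto
    then show ?thesis by (simp add: exp_add mult_ac)
  qed
  have int: "integrable lborel (\<lambda>z. ?X z * ?E z)" "integrable lborel (\<lambda>z. ?Y z * ?E z)"
    "integrable lborel (\<lambda>z. G z * 1 * ?E z)"
    by (rule integrable_gaussian_growth[OF _ growth_mult d(2)],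
        intro continuous_intros G(1), use le d in \<open>simp add: Re_herm inner_commute\<close>)+
  have "(\<integral>z. G z * ph_kernel c a z * ?E z \<partial>lborel)
      = (\<integral>z. ?X z * ?E z + ?Y z * ?E z - G z * 1 * ?E z \<partial>lborel)"
    by (simp add: ph_kernel_def algebra_simps)
  also have "\<dots> = (\<integral>z. ?X z * ?E z \<partial>lborel) + (\<integral>z. ?Y z * ?E z \<partial>lborel) - (\<integral>z. G z * 1 * ?E z \<partial>lborel)"
    using int by (simp only: Bochner_Integration.integral_diff Bochner_Integration.integral_add Bochner_Integration.integrable_add)
  also have "(\<integral>z. G z * 1 * ?E z \<partial>lborel) = G 0 * gauss_mass TYPE(complex ^ 'n) c"
    using integral_gaussian_kernel(1)[OF G growth d, of 0] by (simp add: herm_def)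
  finally show ?thesis
    using integral_gaussian_kernel[OF G growth d, of a] by simp
qed

text \<open>Rotating the orthogonal complement of a unit vector \<open>e\<close> parallel to \<open>a\<close> fixes the kernel and
  averages \<open>f\<close> to its restriction to the line \<open>\<complex>e\<close>, where it is a sum of a holomorphic and an
  antiholomorphic function.\<close>

theorem pluriharmonic_reproducing:
  fixes f :: "complex ^ 'n \<Rightarrow> complex"
  assumes f: "pluriharmonic f"
    and growth: "\<And>z. norm (f z) \<le> C * exp (d * (norm z)\<^sup>2)" and d: "0 \<le> d" "d < c"
  shows "(\<integral>z. f z * ph_kernel c a z * of_real (exp (- c * (norm z)\<^sup>2)) \<partial>lborel)
    = f a * gauss_mass TYPE(complex ^ 'n) c"
proof -
  let ?E = "\<lambda>z :: complex ^ 'n. complex_of_real (exp (- c * (norm z)\<^sup>2))"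
  have cf: "continuous_on A f" for A using f by (rule pluriharmonic_continuous)
  \<comment> \<open>For a = 0 any unit vector serves, so the origin is covered by the same
    argument.\<close>
  obtain e :: "complex ^ 'n" and s :: complex where e: "norm e = 1" and a: "a = s *s e"
  proof (cases "a = 0")
    case True
    have "norm (axis undefined 1 :: complex ^ 'n) = 1" by simp
    then show ?thesis using True by (intro that[of "axis undefined 1" 0]) (auto simp: vec_eq_iff)
  next
    case False
    then show ?thesis
      by (intro that[of "inverse (of_real (norm a)) *s a" "of_real (norm a)"])
         (auto simp: norm_smult_complex vec_eq_iff norm_inverse)
  qed
  have ee: "herm e e = 1" using herm_self[of e] e by simp
  define P where "P z = herm z e *s e" for z
  have Pa: "P a = a" by (simp add: P_def a herm_scale_left ee)
  have orth: "herm (z - P z) e = 0" for z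
    by (simp add: herm_diff_left P_def herm_scale_left ee)
  have linP: "linear P"
    by (rule linearI) (auto simp: P_def herm_def vec_eq_iff algebra_simps sum.distrib simp flip: scaleR_sum_right)
  define U where "U u z = P z + u *s (z - P z)" for u z
  have U_herm: "herm (U u z) a = herm z a" for u z
    unfolding U_def a herm_scale_right herm_add_left herm_scale_left orth
    by (simp add: P_def herm_scale_left ee)
  have U_norm: "norm (U u z) = norm z" if "norm u = 1" for u z
  proof -
    have "orthogonal (P z) (v *s (z - P z))" for v
    proof -
      have "herm (v *s (z - P z)) (P z) = 0"
        unfolding herm_scale_left by (subst (2) P_def) (simp add: herm_scale_right orth)
      then have "(v *s (z - P z)) \<bullet> P z = 0" using Re_herm[of "v *s (z - P z)" "P z"] by simp
      then show ?thesis by (simp add: orthogonal_def inner_commute)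
    qed
    note pyth = norm_add_Pythagorean[OF this]
    have "(norm (U u z))\<^sup>2 = (norm (P z))\<^sup>2 + (norm (z - P z))\<^sup>2"
      unfolding U_def pyth by (simp only: norm_smult_complex that mult_1_left)
    also have "\<dots> = (norm z)\<^sup>2" using pyth[of 1] by simp
    finally show ?thesis by simp
  qed
  have linU: "linear (U u)" for u
  proof -
    have "linear (\<lambda>z. P z + (\<lambda>z. u *s z) (z - P z))"
      by (intro linear_compose_add linP linear_compose[OF _ linear_smult_vec, unfolded o_def]
          linear_compose_sub linear_id[unfolded id_def])
    then show ?thesis by (simp add: U_def[abs_def])
  qed
  obtain g h where g: "g holomorphic_on UNIV" and h: "h holomorphic_on UNIV"
    and gh: "\<And>l. f (0 + l *s e) = g l + cnj (h l)"
    using pluriharmonic_line[OF f] by blast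
  \<comment> \<open>The midpoint leaves room on both sides: above d for splitting f into
    \<open>g\<close> and \<open>h\<close>, below c for convergence.\<close>
  define d' where "d' = (c + d) / 2"
  have d': "0 \<le> d'" "d < d'" "d' < c" using d by (auto simp: d'_def)
  have gh_growth: "norm (g l + cnj (h l)) \<le> C * exp (d * (norm l)\<^sup>2)" for l
    using growth[of "0 + l *s e"] unfolding gh by (simp add: norm_smult_complex e)
  obtain D1 where D1: "\<And>l. norm (g l) \<le> D1 * exp (d' * (norm l)\<^sup>2)"
    using holomorphic_part_growth[OF g h gh_growth d(1) d'(2)] by blast
  have "norm (h l + cnj (g l)) \<le> C * exp (d * (norm l)\<^sup>2)" for l
  proof -
    have "h l + cnj (g l) = cnj (g l + cnj (h l))" by simp
    then show ?thesis using gh_growth[of l] by (metis complex_mod_cnj)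
  qed
  then obtain D2 where D2: "\<And>l. norm (h l) \<le> D2 * exp (d' * (norm l)\<^sup>2)"
    using holomorphic_part_growth[OF h g _ d(1) d'(2)] by blast
  \<comment> \<open>Composition with \<open>herm z e\<close> extends an entire function of one
    variable to the whole space; it stays holomorphic on every line and keeps its growth because e
    is a unit vector.\<close>
  have slice: "continuous_on UNIV (\<lambda>z. k (herm z e))"
    "\<And>z w. (\<lambda>l. k (herm (z + l *s w) e)) holomorphic_on UNIV"
    "\<And>z. norm (k (herm z e)) \<le> D * exp (d' * (norm z)\<^sup>2)"
    if k: "k holomorphic_on UNIV" and D: "\<And>l. norm (k l) \<le> D * exp (d' * (norm l)\<^sup>2)" for k D
  proof -
    show "continuous_on UNIV (\<lambda>z. k (herm z e))"
      by (intro continuous_on_compose2[OF holomorphic_on_imp_continuous_on[OF k]] continuous_intros) auto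
    show "(\<lambda>l. k (herm (z + l *s w) e)) holomorphic_on UNIV" for z w
      unfolding herm_add_left herm_scale_left
      by (intro holomorphic_on_compose_gen[OF _ k, unfolded o_def] holomorphic_intros) auto
    have "D \<ge> 0" using D[of 0] by (simp add: order_trans[OF norm_ge_zero])
    moreover have "(norm (herm z e))\<^sup>2 \<le> (norm z)\<^sup>2" for z
      using norm_herm_le[of z e] e by (intro power_mono) auto
    ultimately show "norm (k (herm z e)) \<le> D * exp (d' * (norm z)\<^sup>2)" for z
      using D[of "herm z e"] d'(1) by (smt (verit) exp_le_cancel_iff mult_left_mono)
  qed
  note G = slice[OF g D1] and H = slice[OF h D2]
  have "(\<integral>z. f z * ph_kernel c a z * ?E z \<partial>lborel)
      = (\<integral>z. (g (herm z e) + cnj (h (herm z e))) * ph_kernel c a z * ?E z \<partial>lborel)"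
  proof (rule circle_average[OF integrable_ph_kernel[OF cf growth d], of U])
    show "continuous_on UNIV (\<lambda>p. U (fst p) (snd p))"
      unfolding U_def P_def by (intro continuous_intros)
    fix z
    have "ph_kernel c a (U u z) = ph_kernel c a z" for u
      using U_herm[of u z] unfolding ph_kernel_def by (metis cnj_herm)
    moreover have "(\<integral>t. f (U (cis (2 * pi * t)) z) \<partial>unit_interval) = g (herm z e) + cnj (h (herm z e))"
      unfolding U_def pluriharmonic_circle_mean[OF f] using gh[of "herm z e"] by (simp add: P_def)
    ultimately show "(\<integral>t. f (U (cis (2 * pi * t)) z) * ph_kernel c a (U (cis (2 * pi * t)) z)
          * ?E (U (cis (2 * pi * t)) z) \<partial>unit_interval)
        = (g (herm z e) + cnj (h (herm z e))) * ph_kernel c a z * ?E z"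
      by (simp add: U_norm)
  qed (auto simp: linU U_norm)
  \<comment> \<open>Kernel and Gaussian are real, so the conjugation can be pulled out and
    \<open>h\<close> handled as an entire function like \<open>g\<close>.\<close>
  also have "\<dots> = (\<integral>z. g (herm z e) * ph_kernel c a z * ?E z
      + cnj (h (herm z e) * ph_kernel c a z * ?E z) \<partial>lborel)"
    by (simp add: algebra_simps cnj_ph_kernel)
  also have "\<dots> = (\<integral>z. g (herm z e) * ph_kernel c a z * ?E z \<partial>lborel)
      + cnj (\<integral>z. h (herm z e) * ph_kernel c a z * ?E z \<partial>lborel)"
    using integrable_ph_kernel[OF G(1) G(3) d'(1,3), of a] integrable_ph_kernel[OF H(1) H(3) d'(1,3), of a]
    by (subst Bochner_Integration.integral_add) (simp_all only: integrable_cnj Bochner_Integration.integral_cnj)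
  also have "\<dots> = g (herm a e) * gauss_mass TYPE(complex ^ 'n) c + cnj (h (herm a e) * gauss_mass TYPE(complex ^ 'n) c)"
    by (simp only: entire_ph_kernel[OF G d'(1,3)] entire_ph_kernel[OF H d'(1,3)])
  also have "\<dots> = f a * gauss_mass TYPE(complex ^ 'n) c"
    using gh[of "herm a e"] Pa by (simp add: P_def algebra_simps)
  finally show ?thesis .
qed

section \<open>Pointwise estimate\<close>

text \<open>The left side is the tangent at m of the convex function x^p; Young's inequality for x/m
  and 1 supplies the convexity.\<close>

lemma powr_above_tangent:
  fixes x m p :: real
  assumes "0 \<le> x" "0 < m" "1 \<le> p"
  shows "m powr p * (p * x / m - (p - 1)) \<le> x powr p"
proof (cases "x = 0")
  case True
  then show ?thesis using assms by (simp add: mult_nonneg_nonpos)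
next
  case False
  define y where "y = x / m"
  have y: "y > 0" using False assms by (simp add: y_def)
  have "(y powr p) powr (1 / p) * 1 powr (1 - 1 / p) \<le> 1 / p * y powr p + (1 - 1 / p) * 1"
    using assms y by (intro Youngs_inequality_0) auto
  then have "y \<le> 1 / p * y powr p + (1 - 1 / p)" using assms y by (simp add: powr_powr)
  then have "p * y \<le> p * (1 / p * y powr p + (1 - 1 / p))" using assms by (intro mult_left_mono) auto
  also have "\<dots> = y powr p + (p - 1)" using assms by (simp add: field_simps)
  finally have "m powr p * (p * y - (p - 1)) \<le> m powr p * y powr p"
    by (intro mult_left_mono) auto
  also have "\<dots> = x powr p" using assms y by (simp add: y_def flip: powr_mult)
  finally show ?thesis by (simp add: y_def)
qed

text \<open>Jensen's inequality for the measure with density k: integrate the tangent at the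
  k-weighted mean \<open>m\<close> of F. A zero mean is treated apart, since the tangent bound asks
  for m > 0.\<close>

lemma integral_powr_le_weighted:
  fixes F k :: "'a \<Rightarrow> real"
  assumes p: "1 \<le> p" and F: "\<And>x. 0 \<le> F x" and k: "\<And>x. 0 \<le> k x" 
    and int: "integrable M k" "integrable M (\<lambda>x. F x * k x)" "integrable M (\<lambda>x. F x powr p * k x)"
    and K: "0 < (\<integral>x. k x \<partial>M)"
  shows "(\<integral>x. F x * k x \<partial>M) powr p \<le> (\<integral>x. k x \<partial>M) powr (p - 1) * (\<integral>x. F x powr p * k x \<partial>M)"
proof -
  let ?K = "\<integral>x. k x \<partial>M" and ?I = "\<integral>x. F x * k x \<partial>M"
  have I: "0 \<le> ?I" using F k by (simp add: integral_nonneg)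
  show ?thesis
  proof (cases "?I = 0")
    case True
    have "0 \<le> (\<integral>x. F x powr p * k x \<partial>M)" using k by (simp add: integral_nonneg)
    then show ?thesis using True by simp
  next
    case False
    define m where "m = ?I / ?K"
    have m: "m > 0" using False I K by (simp add: m_def)
    have "(\<integral>x. m powr p * (p / m * (F x * k x) - (p - 1) * k x) \<partial>M) \<le> (\<integral>x. F x powr p * k x \<partial>M)"
    proof (rule integral_mono)
      show "integrable M (\<lambda>x. m powr p * (p / m * (F x * k x) - (p - 1) * k x))" using int by simp
      fix x
      have "m powr p * (p * F x / m - (p - 1)) * k x \<le> F x powr p * k x"
        using powr_above_tangent[OF F m p] k by (intro mult_right_mono) auto
      then show "m powr p * (p / m * (F x * k x) - (p - 1) * k x) \<le> F x powr p * k x"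
        by (simp add: algebra_simps)
    qed (rule int)
    also have "(\<integral>x. m powr p * (p / m * (F x * k x) - (p - 1) * k x) \<partial>M) = m powr p * (p / m * ?I - (p - 1) * ?K)"
      using int by simp
    also have "p / m * ?I - (p - 1) * ?K = ?K"
      using False K by (simp add: m_def field_simps)
    finally have "?K powr (p - 1) * (m powr p * ?K) \<le> ?K powr (p - 1) * (\<integral>x. F x powr p * k x \<partial>M)"
      by (intro mult_left_mono) auto
    moreover have "?K powr (p - 1) * (m powr p * ?K) = ?I powr p"
    proof -
      have "?K powr (p - 1) * (m powr p * ?K) = m powr p * (?K powr (p - 1) * ?K powr 1)"
        using K by simp
      also have "\<dots> = m powr p * ?K powr p" by (simp only: powr_add[symmetric]) simp
      also have "\<dots> = ?I powr p" using K I by (simp add: m_def flip: powr_mult)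
      finally show ?thesis .
    qed
    ultimately show ?thesis by simp
  qed
qed

text \<open>The reproducing formula with c = 1/\<alpha>, multiplied by exp(-|a|^2/(2\<alpha>)) and
  estimated inside the integral; 3 counts the summands of \<open>ph_kernel\<close>.\<close>

lemma weighted_le_integral:
  fixes f :: "complex ^ 'n \<Rightarrow> complex"
  assumes f: "f \<in> PH_space p \<alpha>" and p: "p \<ge> 1" and \<alpha>: "\<alpha> > 0"
  shows "weighted \<alpha> f a * gauss_mass TYPE(complex ^ 'n) (1 / \<alpha>)
      \<le> 3 * (\<integral>z. weighted \<alpha> f z * exp (- (1 / (4 * \<alpha>)) * (norm (z - a))\<^sup>2) \<partial>lborel)"
    and "integrable lborel (\<lambda>z. weighted \<alpha> f z * exp (- (1 / (4 * \<alpha>)) * (norm (z - a))\<^sup>2))"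
proof -
  let ?k = "\<lambda>z :: complex ^ 'n. exp (- (1 / (4 * \<alpha>)) * (norm (z - a))\<^sup>2)"
  let ?J = "gauss_mass TYPE(complex ^ 'n) (1 / \<alpha>)"
  have J: "?J > 0" using \<alpha> by (intro gauss_mass_pos) simp
  have ph: "pluriharmonic f" using f by (rule PH_space_pluriharmonic)
  have cf: "continuous_on A f" for A using ph by (rule pluriharmonic_continuous)
  have [measurable]: "weighted \<alpha> f \<in> borel_measurable borel" by (rule weighted_measurable[OF cf])
  have k1: "?k z \<le> 1" for z using \<alpha> by simp
  \<comment> \<open>Only the p-th power is known to be integrable; since \<open>?k\<close> is at
    most 1, the product is bounded by \<open>?k\<close> plus that power.\<close>
  show int: "integrable lborel (\<lambda>z. weighted \<alpha> f z * ?k z)"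
  proof (rule Bochner_Integration.integrable_bound)
    show "integrable lborel (\<lambda>z. ?k z + weighted \<alpha> f z powr p)"
      using integrable_gaussian[of "1 / (4 * \<alpha>)" a] \<alpha> PH_space_integrable[OF f] by simp
    show "AE z in lborel. norm (weighted \<alpha> f z * ?k z) \<le> norm (?k z + weighted \<alpha> f z powr p)"
    proof (rule AE_I2)
      fix z :: "complex ^ 'n"
      have "weighted \<alpha> f z * ?k z \<le> (1 + weighted \<alpha> f z powr p) * ?k z"
        using le_one_plus_powr[OF weighted_nonneg p] by (intro mult_right_mono) auto
      also have "\<dots> \<le> ?k z + weighted \<alpha> f z powr p"
        using mult_left_mono[OF k1, of "weighted \<alpha> f z powr p"] by (simp add: algebra_simps)
      finally show "norm (weighted \<alpha> f z * ?k z) \<le> norm (?k z + weighted \<alpha> f z powr p)"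
        using weighted_nonneg[of \<alpha> f z] by simp
    qed
  qed measurable
  obtain C where C: "\<And>z. norm (f z) \<le> C * exp (5 / (8 * \<alpha>) * (norm z)\<^sup>2)"
    using PH_space_growth[OF f p \<alpha>] by blast
  have d: "0 \<le> 5 / (8 * \<alpha>)" "5 / (8 * \<alpha>) < 1 / \<alpha>" using \<alpha> by (auto simp: field_simps)
  let ?Q = "\<lambda>z. f z * ph_kernel (1 / \<alpha>) a z * of_real (exp (- (1 / \<alpha>) * (norm z)\<^sup>2))"
  let ?A = "exp (- (norm a)\<^sup>2 / (2 * \<alpha>))"
  have "weighted \<alpha> f a * ?J = ?A * norm (f a * ?J)"
    using J by (simp add: weighted_def norm_mult)
  also have "f a * ?J = (\<integral>z. ?Q z \<partial>lborel)"
    by (rule pluriharmonic_reproducing[OF ph C d, symmetric])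
  also have "?A * norm (\<integral>z. ?Q z \<partial>lborel) \<le> ?A * (\<integral>z. norm (?Q z) \<partial>lborel)"
    by (intro mult_left_mono integral_norm_bound) simp
  also have "\<dots> = (\<integral>z. ?A * norm (?Q z) \<partial>lborel)" by simp
  also have "\<dots> \<le> (\<integral>z. 3 * (weighted \<alpha> f z * ?k z) \<partial>lborel)"
  proof (rule integral_mono)
    show "integrable lborel (\<lambda>z. ?A * norm (?Q z))"
      using integrable_ph_kernel[OF cf C d, of a] by (intro integrable_mult_right integrable_norm)
    show "integrable lborel (\<lambda>z. 3 * (weighted \<alpha> f z * ?k z))" using int by (rule integrable_mult_right)
    fix z :: "complex ^ 'n"
    let ?Z = "exp (- (norm z)\<^sup>2 / (2 * \<alpha>))"
    \<comment> \<open>One factor \<open>?Z\<close> is spent on \<open>weighted \<alpha> f z\<close>,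
      the other joins \<open>?A\<close> and the kernel.\<close>
    have Z: "exp (- (1 / \<alpha>) * (norm z)\<^sup>2) = ?Z * ?Z"
      using \<alpha> by (simp add: field_simps flip: exp_add)
    have dist: "(norm (z - a))\<^sup>2 = (norm z)\<^sup>2 + (norm a)\<^sup>2 - 2 * (z \<bullet> a)"
      by (simp add: power2_norm_eq_inner inner_diff inner_commute)
    have "?A * ?Z * exp (1 / \<alpha> * (z \<bullet> a)) \<le> ?k z"
    proof -
      have "?A * ?Z * exp (1 / \<alpha> * (z \<bullet> a)) = exp (- (1 / (2 * \<alpha>)) * (norm (z - a))\<^sup>2)"
        unfolding dist exp_add[symmetric] using \<alpha> by (simp add: field_simps)
      also have "\<dots> \<le> ?k z" using \<alpha> by (simp add: divide_right_mono field_simps)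
      finally show ?thesis .
    qed
    \<comment> \<open>This is the constant summand of the kernel. The exponentials alone would give
      decay 1/(2\<alpha>); this term lowers the common rate to 1/(4\<alpha>).\<close>
    moreover have "?A * ?Z \<le> ?k z"
    proof -
      have "(norm (z - a))\<^sup>2 \<le> 2 * ((norm z)\<^sup>2 + (norm a)\<^sup>2)"
      proof -
        have "(norm (z - a))\<^sup>2 \<le> (norm z + norm a)\<^sup>2"
          by (intro power_mono norm_triangle_ineq4) simp
        also have "\<dots> \<le> 2 * ((norm z)\<^sup>2 + (norm a)\<^sup>2)"
          using zero_le_power2[of "norm z - norm a"] by (simp add: power2_eq_square algebra_simps)
        finally show ?thesis .
      qed
      then have "(norm (z - a))\<^sup>2 / (4 * \<alpha>) \<le> 2 * ((norm z)\<^sup>2 + (norm a)\<^sup>2) / (4 * \<alpha>)"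
        using \<alpha> by (intro divide_right_mono) auto
      also have "\<dots> = (norm a)\<^sup>2 / (2 * \<alpha>) + (norm z)\<^sup>2 / (2 * \<alpha>)" using \<alpha> by (simp add: field_simps)
      finally show ?thesis by (simp flip: exp_add)
    qed
    ultimately have *: "?A * ?Z * (2 * exp (1 / \<alpha> * (z \<bullet> a)) + 1) \<le> 3 * ?k z"
      by (simp add: distrib_left)
    have "?A * ?Z * norm (ph_kernel (1 / \<alpha>) a z) \<le> ?A * ?Z * (2 * exp (1 / \<alpha> * (z \<bullet> a)) + 1)"
      by (intro mult_left_mono norm_ph_kernel_le) simp
    then have "?A * ?Z * norm (ph_kernel (1 / \<alpha>) a z) \<le> 3 * ?k z"
      using * by (rule order_trans)
    then have le: "weighted \<alpha> f z * (?A * ?Z * norm (ph_kernel (1 / \<alpha>) a z)) \<le> weighted \<alpha> f z * (3 * ?k z)"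
      by (intro mult_left_mono weighted_nonneg)
    have "?A * norm (?Q z) = weighted \<alpha> f z * (?A * ?Z * norm (ph_kernel (1 / \<alpha>) a z))"
      unfolding Z by (simp add: weighted_def norm_mult mult_ac)
    also note le
    also have "weighted \<alpha> f z * (3 * ?k z) = 3 * (weighted \<alpha> f z * ?k z)" by simp
    finally show "?A * norm (?Q z) \<le> 3 * (weighted \<alpha> f z * ?k z)" .
  qed
  finally show "weighted \<alpha> f a * ?J \<le> 3 * (\<integral>z. weighted \<alpha> f z * ?k z \<partial>lborel)" by simp
qed

text \<open>Jensen's inequality for the Gaussian around a. The constant is fixed before f and a, and
  the Carleson estimate rests on this uniformity.\<close>

lemma weighted_powr_le_integral:
  assumes p: "p \<ge> 1" and \<alpha>: "\<alpha> > 0"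
  obtains A where "A > 0" "\<And>(f :: complex ^ 'n \<Rightarrow> complex) a. f \<in> PH_space p \<alpha> \<Longrightarrow>
    ennreal (weighted \<alpha> f a powr p)
      \<le> ennreal A * (\<integral>\<^sup>+z. ennreal (weighted \<alpha> f z powr p) * ennreal (exp (- (1 / (4 * \<alpha>)) * (norm (z - a))\<^sup>2)) \<partial>lborel)"
proof
  let ?J = "gauss_mass TYPE(complex ^ 'n) (1 / \<alpha>)" and ?K = "gauss_mass TYPE(complex ^ 'n) (1 / (4 * \<alpha>))"
  have J: "?J > 0" and K: "?K > 0" using \<alpha> by (auto intro!: gauss_mass_pos)
  \<comment> \<open>The first factor comes from raising the pointwise estimate to the power p, the
    second from Jensen's inequality for a measure of mass \<open>?K\<close>.\<close>
  let ?A = "(3 / ?J) powr p * ?K powr (p - 1)"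
  show "?A > 0" using J K by simp
  fix f :: "complex ^ 'n \<Rightarrow> complex" and a :: "complex ^ 'n"
  assume f: "f \<in> PH_space p \<alpha>"
  let ?k = "\<lambda>z :: complex ^ 'n. exp (- (1 / (4 * \<alpha>)) * (norm (z - a))\<^sup>2)"
  have [measurable]: "weighted \<alpha> f \<in> borel_measurable borel"
    by (intro weighted_measurable pluriharmonic_continuous PH_space_pluriharmonic[OF f])
  have k: "integrable lborel ?k" using integrable_gaussian[of "1 / (4 * \<alpha>)" a] \<alpha> by simp
  have Kk: "(\<integral>z. ?k z \<partial>lborel) = ?K"
    using lborel_integral_shift[of "\<lambda>z :: complex ^ 'n. exp (- (1 / (4 * \<alpha>)) * (norm z)\<^sup>2)" "- a"]
    by (simp add: gauss_mass_def)
  note Fk = weighted_le_integral[OF f p \<alpha>, of a]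
  have Fpk: "integrable lborel (\<lambda>z. weighted \<alpha> f z powr p * ?k z)"
    by (rule Bochner_Integration.integrable_bound[OF PH_space_integrable[OF f]])
       (use \<alpha> in \<open>auto intro!: AE_I2 mult_left_le simp: abs_mult\<close>)
  let ?I = "\<integral>z. weighted \<alpha> f z * ?k z \<partial>lborel"
  have I: "0 \<le> ?I" by (simp add: integral_nonneg weighted_nonneg)
  have "weighted \<alpha> f a \<le> 3 / ?J * ?I" using Fk(1) J by (simp add: field_simps)
  then have "weighted \<alpha> f a powr p \<le> (3 / ?J * ?I) powr p"
    using p by (intro powr_mono2 weighted_nonneg) auto
  also have "\<dots> = (3 / ?J) powr p * ?I powr p" by (rule powr_mult)
  also have "?I powr p \<le> ?K powr (p - 1) * (\<integral>z. weighted \<alpha> f z powr p * ?k z \<partial>lborel)"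
    using integral_powr_le_weighted[OF p weighted_nonneg _ k Fk(2) Fpk] K unfolding Kk by simp
  finally have "weighted \<alpha> f a powr p \<le> ?A * (\<integral>z. weighted \<alpha> f z powr p * ?k z \<partial>lborel)"
    by (simp add: mult.assoc mult_left_mono)
  then have "ennreal (weighted \<alpha> f a powr p) \<le> ennreal ?A * ennreal (\<integral>z. weighted \<alpha> f z powr p * ?k z \<partial>lborel)"
    by (simp add: ennreal_mult'[symmetric] ennreal_leI)
  also have "ennreal (\<integral>z. weighted \<alpha> f z powr p * ?k z \<partial>lborel)
      = (\<integral>\<^sup>+z. ennreal (weighted \<alpha> f z powr p) * ennreal (?k z) \<partial>lborel)"
    using Fpk by (subst nn_integral_eq_integral[symmetric]) (auto simp: ennreal_mult)
  finally show "ennreal (weighted \<alpha> f a powr p) \<le> ennreal ?A *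
      (\<integral>\<^sup>+z. ennreal (weighted \<alpha> f z powr p) * ennreal (?k z) \<partial>lborel)" .
qed

section \<open>Carleson measures\<close>

text \<open>Balls around a countable dense set cover the space; sigma-finiteness is what Tonelli's
  theorem requires of \<mu>.\<close>

lemma sigma_finite_measure_of_balls:
  fixes \<mu> :: "'a::euclidean_space measure"
  assumes sets: "sets \<mu> = sets borel" and r: "r > 0"
    and fin: "\<And>a. emeasure \<mu> (ball a r) < \<infinity>"
  shows "sigma_finite_measure \<mu>"
proof
  obtain D :: "'a set" where D: "countable D" "\<And>X. open X \<Longrightarrow> X \<noteq> {} \<Longrightarrow> \<exists>d\<in>D. d \<in> X"
    using countable_dense_exists by blast
  have "x \<in> \<Union> ((\<lambda>d. ball d r) ` D)" for x
    using D(2)[of "ball x r"] r by (auto simp: dist_commute)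
  then show "\<exists>A. countable A \<and> A \<subseteq> sets \<mu> \<and> \<Union> A = space \<mu> \<and> (\<forall>a\<in>A. emeasure \<mu> a \<noteq> \<infinity>)"
    using D(1) fin sets_eq_imp_space_eq[OF sets]
    by (intro exI[of _ "(\<lambda>d. ball d r) ` D"]) (auto simp: sets less_top)
qed

text \<open>The Gaussian at a is dominated by its wider version averaged over w in the ball around
  a. Exchanging the integrals leaves a Gaussian integral in w against \<mu>(ball w r), uniformly
  bounded in z.\<close>

lemma ball_bounded_imp_gaussian_bounded:
  fixes \<mu> :: "'a::euclidean_space measure"
  assumes sets[measurable_cong]: "sets \<mu> = sets borel" and r: "r > 0" and c: "c > 0"
    and C: "\<And>a. emeasure \<mu> (ball a r) \<le> ennreal C"
  obtains D where "D > 0" "\<And>z. (\<integral>\<^sup>+a. ennreal (exp (- c * (norm (z - a))\<^sup>2)) \<partial>\<mu>) \<le> ennreal D"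
proof -
  interpret \<mu>: sigma_finite_measure \<mu>
    by (intro sigma_finite_measure_of_balls[OF sets r] le_less_trans[OF C]) simp
  interpret P: pair_sigma_finite \<mu> "lborel :: 'a measure" ..
  define V where "V = measure lborel (ball (0::'a) r)"
  have V: "V > 0" unfolding V_def using r by (rule content_ball_pos)
  have Vball: "emeasure lborel (ball a r) = ennreal V" for a :: 'a
  proof -
    have "emeasure lborel (ball a r) = (\<integral>\<^sup>+x. indicator (ball a r) (a + x) \<partial>lborel)"
      by (subst nn_integral_lborel_shift) (auto intro!: borel_measurable_indicator)
    also have "(\<lambda>x. indicator (ball a r) (a + x) :: ennreal) = indicator (ball 0 r)"
      by (auto simp: indicator_def dist_norm)
    finally show ?thesis
      using emeasure_lborel_ball_finite[of "0::'a" r] by (simp add: V_def emeasure_eq_ennreal_measure less_top)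
  qed
  define G where "G = (\<integral>x. exp (- (c / 2) * (norm (x::'a))\<^sup>2) \<partial>lborel)"
  have G: "(\<integral>\<^sup>+w. ennreal (exp (- (c / 2) * (norm (z - w))\<^sup>2)) \<partial>lborel) = ennreal G" for z :: 'a
  proof -
    have "(\<integral>\<^sup>+w. ennreal (exp (- (c / 2) * (norm (z - w))\<^sup>2)) \<partial>lborel)
        = (\<integral>\<^sup>+w. ennreal (exp (- (c / 2) * (norm (w::'a))\<^sup>2)) \<partial>lborel)"
      by (rule nn_integral_lborel_reflect) measurable
    also have "\<dots> = ennreal G"
      unfolding G_def using integrable_gaussian[of "c / 2" "0::'a"] c
      by (intro nn_integral_eq_integral) auto
    finally show ?thesis .
  qed
  \<comment> \<open>The relation is open, hence jointly measurable, and symmetric: fixing a gives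
    \<open>ball a r\<close>, fixing w gives \<open>ball w r\<close>.\<close>
  let ?S = "{p :: 'a \<times> 'a. dist (fst p) (snd p) < r}"
  have "open ?S" by (intro open_Collect_less continuous_intros)
  then have [measurable]: "?S \<in> sets (borel \<Otimes>\<^sub>M borel)" unfolding borel_prod by (rule borel_open)
  have pointwise: "ennreal V * ennreal (exp (- c * (norm (z - a))\<^sup>2))
      \<le> (\<integral>\<^sup>+w. ennreal (exp (c * r\<^sup>2)) * (ennreal (exp (- (c / 2) * (norm (z - w))\<^sup>2)) * indicator ?S (a, w)) \<partial>lborel)" for z a
  proof -
    have "ennreal V * ennreal (exp (- c * (norm (z - a))\<^sup>2))
        = (\<integral>\<^sup>+w. ennreal (exp (- c * (norm (z - a))\<^sup>2)) * indicator (ball a r) w \<partial>lborel)"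
      by (subst nn_integral_cmult_indicator) (auto simp: Vball mult.commute)
    also have "\<dots> \<le> (\<integral>\<^sup>+w. ennreal (exp (c * r\<^sup>2)) * (ennreal (exp (- (c / 2) * (norm (z - w))\<^sup>2)) * indicator ?S (a, w)) \<partial>lborel)"
    proof (rule nn_integral_mono)
      fix w
      show "ennreal (exp (- c * (norm (z - a))\<^sup>2)) * indicator (ball a r) w
          \<le> ennreal (exp (c * r\<^sup>2)) * (ennreal (exp (- (c / 2) * (norm (z - w))\<^sup>2)) * indicator ?S (a, w))"
      proof (cases "w \<in> ball a r")
        case True
        have "norm (z - w) \<le> norm (z - a) + norm (a - w)"
          using norm_triangle_ineq[of "z - a" "a - w"] by simp
        also have "\<dots> \<le> norm (z - a) + r" using True by (simp add: dist_norm)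
        finally have "(norm (z - w))\<^sup>2 \<le> (norm (z - a) + r)\<^sup>2" by (intro power_mono) auto
        \<comment> \<open>The factor 2 halves the exponent from c to c/2, and the term in r becomes
          the constant exp(c r^2).\<close>
        also have "\<dots> \<le> 2 * (norm (z - a))\<^sup>2 + 2 * r\<^sup>2"
          using zero_le_power2[of "norm (z - a) - r"] by (simp add: power2_eq_square algebra_simps)
        finally have "c / 2 * (norm (z - w))\<^sup>2 \<le> c / 2 * (2 * (norm (z - a))\<^sup>2 + 2 * r\<^sup>2)"
          using c by (intro mult_left_mono) auto
        then have "- c * (norm (z - a))\<^sup>2 \<le> c * r\<^sup>2 + - (c / 2) * (norm (z - w))\<^sup>2"
          by (simp add: algebra_simps)
        then have "exp (- c * (norm (z - a))\<^sup>2) \<le> exp (c * r\<^sup>2) * exp (- (c / 2) * (norm (z - w))\<^sup>2)"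
          by (simp flip: exp_add)
        then show ?thesis using True by (simp add: ennreal_leI flip: ennreal_mult)
      qed simp
    qed
    finally show ?thesis .
  qed
  have main: "ennreal V * (\<integral>\<^sup>+a. ennreal (exp (- c * (norm (z - a))\<^sup>2)) \<partial>\<mu>) \<le> ennreal (exp (c * r\<^sup>2)) * (ennreal G * ennreal C)" for z
  proof -
    have "ennreal V * (\<integral>\<^sup>+a. ennreal (exp (- c * (norm (z - a))\<^sup>2)) \<partial>\<mu>)
        = (\<integral>\<^sup>+a. ennreal V * ennreal (exp (- c * (norm (z - a))\<^sup>2)) \<partial>\<mu>)"
      by (subst nn_integral_cmult) auto
    also have "\<dots> \<le> (\<integral>\<^sup>+a. (\<integral>\<^sup>+w. ennreal (exp (c * r\<^sup>2)) * (ennreal (exp (- (c / 2) * (norm (z - w))\<^sup>2)) * indicator ?S (a, w)) \<partial>lborel) \<partial>\<mu>)"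
      by (intro nn_integral_mono pointwise)
    also have "\<dots> = (\<integral>\<^sup>+w. (\<integral>\<^sup>+a. ennreal (exp (c * r\<^sup>2)) * (ennreal (exp (- (c / 2) * (norm (z - w))\<^sup>2)) * indicator ?S (a, w)) \<partial>\<mu>) \<partial>lborel)"
      by (rule P.Fubini'[symmetric]) measurable
    also have "\<dots> = (\<integral>\<^sup>+w. ennreal (exp (c * r\<^sup>2)) * (ennreal (exp (- (c / 2) * (norm (z - w))\<^sup>2)) * emeasure \<mu> (ball w r)) \<partial>lborel)"
    proof (rule nn_integral_cong)
      fix w
      have "(\<lambda>a. indicator ?S (a, w) :: ennreal) = indicator (ball w r)"
        by (auto simp: indicator_def dist_commute)
      then have "(\<integral>\<^sup>+a. indicator ?S (a, w) \<partial>\<mu>) = emeasure \<mu> (ball w r)"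
        by (simp add: sets)
      then show "(\<integral>\<^sup>+a. ennreal (exp (c * r\<^sup>2)) * (ennreal (exp (- (c / 2) * (norm (z - w))\<^sup>2)) * indicator ?S (a, w)) \<partial>\<mu>)
          = ennreal (exp (c * r\<^sup>2)) * (ennreal (exp (- (c / 2) * (norm (z - w))\<^sup>2)) * emeasure \<mu> (ball w r))"
        by (simp add: nn_integral_cmult)
    qed
    also have "\<dots> \<le> (\<integral>\<^sup>+w. ennreal (exp (c * r\<^sup>2)) * (ennreal (exp (- (c / 2) * (norm (z - w))\<^sup>2)) * ennreal C) \<partial>lborel)"
      by (intro nn_integral_mono mult_left_mono C) auto
    also have "\<dots> = ennreal (exp (c * r\<^sup>2)) * (ennreal G * ennreal C)"
      using G[of z] by (simp add: nn_integral_cmult nn_integral_multc)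
    finally show ?thesis .
  qed
  have "G \<ge> 0" by (simp add: G_def integral_nonneg)
  show ?thesis
  proof (rule that)
    \<comment> \<open>The absolute value is there because no sign of \<open>C\<close> is assumed,
      the summand 1 for strict positivity.\<close>
    let ?D = "exp (c * r\<^sup>2) * (G * \<bar>C\<bar>) / V + 1"
    show "?D > 0" using V \<open>G \<ge> 0\<close> by (simp add: add_nonneg_pos)
    fix z
    let ?X = "\<integral>\<^sup>+a. ennreal (exp (- c * (norm (z - a))\<^sup>2)) \<partial>\<mu>"
    have "ennreal V * ?X \<le> ennreal (exp (c * r\<^sup>2) * (G * \<bar>C\<bar>))"
      using \<open>G \<ge> 0\<close>
      by (intro order_trans[OF main]) (simp add: ennreal_mult ennreal_leI mult_left_mono)
    then have "ennreal (1 / V) * (ennreal V * ?X) \<le> ennreal (1 / V) * ennreal (exp (c * r\<^sup>2) * (G * \<bar>C\<bar>))"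
      by (intro mult_left_mono) auto
    also have "ennreal (1 / V) * (ennreal V * ?X) = ?X"
      using V by (simp add: mult.assoc[symmetric] ennreal_mult[symmetric])
    also have "ennreal (1 / V) * ennreal (exp (c * r\<^sup>2) * (G * \<bar>C\<bar>)) \<le> ennreal ?D"
      using V by (simp add: ennreal_mult'[symmetric] ennreal_leI)
    finally show "?X \<le> ennreal ?D" .
  qed
qed

lemma ball_bounded_imp_weighted_integral_le:
  fixes \<mu> :: "(complex ^ 'n) measure"
  assumes sets[measurable_cong]: "sets \<mu> = sets borel" and p: "p \<ge> 1" and \<alpha>: "\<alpha> > 0" and r: "r > 0"
    and C: "\<And>a. emeasure \<mu> (ball a r) \<le> ennreal C"
  obtains B where "B > 0"
    "\<And>f. f \<in> PH_space p \<alpha> \<Longrightarrow> weighted_integral p \<alpha> \<mu> f \<le> ennreal B * weighted_integral p \<alpha> lebesgue f"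
proof -
  interpret \<mu>: sigma_finite_measure \<mu>
    by (intro sigma_finite_measure_of_balls[OF sets r] le_less_trans[OF C]) simp
  interpret P: pair_sigma_finite \<mu> "lborel :: (complex ^ 'n) measure" ..
  let ?k = "\<lambda>z a :: complex ^ 'n. ennreal (exp (- (1 / (4 * \<alpha>)) * (norm (z - a))\<^sup>2))"
  obtain A where A: "A > 0" "\<And>(f :: complex ^ 'n \<Rightarrow> complex) a. f \<in> PH_space p \<alpha> \<Longrightarrow>
    ennreal (weighted \<alpha> f a powr p)
      \<le> ennreal A * (\<integral>\<^sup>+z. ennreal (weighted \<alpha> f z powr p) * ?k z a \<partial>lborel)"
    using weighted_powr_le_integral[OF p \<alpha>] by blast
  obtain D where D: "D > 0" "\<And>z. (\<integral>\<^sup>+a. ?k z a \<partial>\<mu>) \<le> ennreal D"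
    using ball_bounded_imp_gaussian_bounded[OF sets r _ C, of "1 / (4 * \<alpha>)"] \<alpha> by auto
  show ?thesis
  proof (rule that)
    show "A * D > 0" using A(1) D(1) by simp
    fix f :: "complex ^ 'n \<Rightarrow> complex" assume f: "f \<in> PH_space p \<alpha>"
    have [measurable]: "weighted \<alpha> f \<in> borel_measurable borel"
      by (intro weighted_measurable pluriharmonic_continuous PH_space_pluriharmonic[OF f])
    have "(\<integral>\<^sup>+a. (\<integral>\<^sup>+z. ennreal (weighted \<alpha> f z powr p) * ?k z a \<partial>lborel) \<partial>\<mu>)
        = (\<integral>\<^sup>+z. (\<integral>\<^sup>+a. ennreal (weighted \<alpha> f z powr p) * ?k z a \<partial>\<mu>) \<partial>lborel)"
      by (rule P.Fubini'[symmetric]) measurable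
    also have "\<dots> = (\<integral>\<^sup>+z. ennreal (weighted \<alpha> f z powr p) * (\<integral>\<^sup>+a. ?k z a \<partial>\<mu>) \<partial>lborel)"
      by (intro nn_integral_cong nn_integral_cmult) measurable
    also have "\<dots> \<le> (\<integral>\<^sup>+z. ennreal (weighted \<alpha> f z powr p) * ennreal D \<partial>lborel)"
      by (intro nn_integral_mono mult_left_mono D(2)) simp
    also have "\<dots> = ennreal D * weighted_integral p \<alpha> lebesgue f"
      by (simp add: weighted_integral_lborel nn_integral_multc mult.commute[of "ennreal D"])
    finally have le: "(\<integral>\<^sup>+a. (\<integral>\<^sup>+z. ennreal (weighted \<alpha> f z powr p) * ?k z a \<partial>lborel) \<partial>\<mu>)
        \<le> ennreal D * weighted_integral p \<alpha> lebesgue f" .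
    have "weighted_integral p \<alpha> \<mu> f = (\<integral>\<^sup>+a. ennreal (weighted \<alpha> f a powr p) \<partial>\<mu>)"
      by (simp add: weighted_integral_def weighted_def)
    also have "\<dots> \<le> (\<integral>\<^sup>+a. ennreal A * (\<integral>\<^sup>+z. ennreal (weighted \<alpha> f z powr p) * ?k z a \<partial>lborel) \<partial>\<mu>)"
      by (intro nn_integral_mono A(2) f)
    also have "\<dots> = ennreal A * (\<integral>\<^sup>+a. (\<integral>\<^sup>+z. ennreal (weighted \<alpha> f z powr p) * ?k z a \<partial>lborel) \<partial>\<mu>)"
      by (rule nn_integral_cmult) measurable
    also have "\<dots> \<le> ennreal A * (ennreal D * weighted_integral p \<alpha> lebesgue f)"
      by (intro mult_left_mono le) simp
    finally show "weighted_integral p \<alpha> \<mu> f \<le> ennreal (A * D) * weighted_integral p \<alpha> lebesgue f"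
      using A(1) D(1) by (simp add: ennreal_mult mult.assoc)
  qed
qed

lemma ball_bounded_imp_Carleson:
  fixes \<mu> :: "(complex ^ 'n) measure"
  assumes sets: "sets \<mu> = sets borel" and p: "p \<ge> 1" and \<alpha>: "\<alpha> > 0" and r: "r > 0"
    and C: "\<And>a. emeasure \<mu> (ball a r) \<le> ennreal C"
  shows "Carleson_PH p \<alpha> \<mu>"
proof -
  obtain B where B: "B > 0"
    "\<And>f. f \<in> PH_space p \<alpha> \<Longrightarrow> weighted_integral p \<alpha> \<mu> f \<le> ennreal B * weighted_integral p \<alpha> lebesgue f"
    using ball_bounded_imp_weighted_integral_le[OF assms] by blast
  define N where "N = p ^ CARD('n) / (2 * pi * \<alpha>) ^ CARD('n)"
  have N: "N > 0" using p \<alpha> by (simp add: N_def)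
  show ?thesis
    unfolding Carleson_PH_def
  \<comment> \<open>Dividing by \<open>N\<close>, the normalising factor inside
    \<open>Lp_norm\<close>, converts the bound between integrals into one between norms.\<close>
  proof (intro exI[of _ "(B / N) powr (1 / p)"] conjI ballI)
    show "(B / N) powr (1 / p) > 0" using B N by simp
    fix f :: "complex ^ 'n \<Rightarrow> complex" assume f: "f \<in> PH_space p \<alpha>"
    let ?W = "weighted_integral p \<alpha> lebesgue f"
    have W: "?W < \<infinity>" using f by (simp add: PH_space_def Lp_space_def)
    then show fin: "weighted_integral p \<alpha> \<mu> f < \<infinity>"
      using B(2)[OF f] by (auto intro: le_less_trans simp: ennreal_mult_less_top)
    have "enn2real (weighted_integral p \<alpha> \<mu> f) \<le> enn2real (ennreal B * ?W)"
      using B(2)[OF f] W by (intro enn2real_mono) (auto simp: ennreal_mult_less_top)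
    also have "\<dots> = B / N * (N * enn2real ?W)" using B N by (simp add: enn2real_mult)
    finally have "enn2real (weighted_integral p \<alpha> \<mu> f) powr (1 / p) \<le> (B / N * (N * enn2real ?W)) powr (1 / p)"
      using p by (intro powr_mono2) auto
    also have "\<dots> = (B / N) powr (1 / p) * (N * enn2real ?W) powr (1 / p)"
      by (rule powr_mult)
    finally show "enn2real (weighted_integral p \<alpha> \<mu> f) powr (1 / p) \<le> (B / N) powr (1 / p) * Lp_norm p \<alpha> f"
      by (simp add: Lp_norm_def N_def)
  qed
qed

section \<open>Gaussian test functions and the bound on balls\<close>

lemma herm_axis: "herm (axis j c) b = c * cnj (b $ j)"
proof -
  have "herm (axis j c) b = (\<Sum>k\<in>UNIV. if k = j then c * cnj (b $ k) else 0)"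
    unfolding herm_def by (intro sum.cong) (auto simp: axis_def)
  then show ?thesis by simp
qed

text \<open>Directional derivatives only change the factor k, so first-order smoothness for every k
  already yields \<open>C2_fun\<close>; holomorphy in z makes \<open>d_zbar\<close> vanish.\<close>

lemma pluriharmonic_exp_herm:
  fixes b :: "complex ^ 'n"
  shows "pluriharmonic (\<lambda>z. k * exp (herm z b))"
proof -
  have bl: "bounded_linear (\<lambda>z. herm z b)"
    unfolding linear_conv_bounded_linear[symmetric]
    by (rule linearI) (simp_all add: herm_add_left, simp add: herm_def scaleR_sum_right)
  have D: "((\<lambda>z. k * exp (herm z b)) has_derivative (\<lambda>v. k * herm v b * exp (herm z b))) (at z)" for k z
    using has_derivative_mult_right[OF has_derivative_compose[OF bounded_linear_imp_has_derivative[OF bl]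
        DERIV_exp[unfolded has_field_derivative_def]], of k]
    by (simp add: mult_ac)
  have fd: "frechet_derivative (\<lambda>z. k * exp (herm z b)) (at z) = (\<lambda>v. k * herm v b * exp (herm z b))" for k z
    using frechet_derivative_at[OF D] by simp
  have C1: "C1_fun (\<lambda>z. k * exp (herm z b))" for k
    unfolding C1_fun_def fd using D by (auto simp: differentiable_def intro!: continuous_intros)
  have "d_zbar j (\<lambda>z. k * exp (herm z b)) = (\<lambda>_. 0)" for j
    by (rule ext) (simp add: d_zbar_def fd herm_axis algebra_simps)
  then show ?thesis
    unfolding pluriharmonic_def C2_fun_def using C1 by (auto simp: fd d_z_def)
qed

text \<open>By translation invariance the test functions have the same norm for every a, while on
  the ball their weighted p-th power is at least exp(-c r^2).\<close>

lemma Carleson_imp_ball_bounded: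
  fixes \<mu> :: "(complex ^ 'n) measure"
  assumes sets[measurable_cong]: "sets \<mu> = sets borel" and p: "p \<ge> 1" and \<alpha>: "\<alpha> > 0"
    and Carleson: "Carleson_PH p \<alpha> \<mu>"
  shows "\<exists>C>0. \<forall>a. emeasure \<mu> (ball a r) \<le> ennreal C"
proof -
  obtain C where C: "C > 0" "\<And>f. f \<in> PH_space p \<alpha> \<Longrightarrow> weighted_integral p \<alpha> \<mu> f < \<infinity>"
    "\<And>f. f \<in> PH_space p \<alpha> \<Longrightarrow> enn2real (weighted_integral p \<alpha> \<mu> f) powr (1 / p) \<le> C * Lp_norm p \<alpha> f"
    using Carleson by (auto simp: Carleson_PH_def)
  define c where "c = p / (2 * \<alpha>)"
  have c: "c > 0" using p \<alpha> by (simp add: c_def)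
  define f where "f a z = of_real (exp (- (norm a)\<^sup>2 / (2 * \<alpha>))) * exp (herm z (of_real (1 / \<alpha>) *s a))" 
    for a z :: "complex ^ 'n"
  have weighted_f: "weighted \<alpha> (f a) z powr p = exp (- c * (norm (z - a))\<^sup>2)" for a z
  proof -
    have "weighted \<alpha> (f a) z = exp (- (norm a)\<^sup>2 / (2 * \<alpha>) + z \<bullet> a / \<alpha> + - (norm z)\<^sup>2 / (2 * \<alpha>))"
      unfolding exp_add by (simp add: weighted_def f_def norm_mult herm_scale_right Re_herm)
    also have "- (norm a)\<^sup>2 / (2 * \<alpha>) + z \<bullet> a / \<alpha> + - (norm z)\<^sup>2 / (2 * \<alpha>) = - (norm (z - a))\<^sup>2 / (2 * \<alpha>)"
      using \<alpha> by (simp add: power2_norm_eq_inner inner_diff inner_commute field_simps)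
    finally show ?thesis by (simp add: exp_powr_real c_def mult.commute)
  qed
  define W where "W = (\<integral>\<^sup>+z. ennreal (exp (- c * (norm (z :: complex ^ 'n))\<^sup>2)) \<partial>lborel)"
  have W: "W < \<infinity>" unfolding W_def using nn_integral_gaussian_finite[OF c, of 0] by simp
  have int_f: "weighted_integral p \<alpha> lebesgue (f a) = W" for a
    using nn_integral_lborel_shift[of "\<lambda>z :: complex ^ 'n. ennreal (exp (- c * (norm z)\<^sup>2))" "- a"]
    by (simp add: weighted_integral_lborel weighted_f W_def)
  have ph: "pluriharmonic (f a)" for a
    unfolding f_def[abs_def] by (rule pluriharmonic_exp_herm)
  have "f a \<in> borel_measurable borel" for a
    by (intro borel_measurable_continuous_onI pluriharmonic_continuous ph)
  then have "f a \<in> borel_measurable lebesgue" for a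
    by (intro measurable_completion) simp
  then have f_PH: "f a \<in> PH_space p \<alpha>" for a
    using W ph int_f by (simp add: PH_space_def Lp_space_def)
  define L where "L = (p ^ CARD('n) / (2 * pi * \<alpha>) ^ CARD('n) * enn2real W) powr (1 / p)"
  have bound: "weighted_integral p \<alpha> \<mu> (f a) \<le> ennreal ((C * L) powr p)" for a
  proof -
    let ?w = "enn2real (weighted_integral p \<alpha> \<mu> (f a))"
    have "?w powr (1 / p) \<le> C * L"
      using C(3)[OF f_PH, of a] by (simp add: Lp_norm_def int_f L_def)
    then have "(?w powr (1 / p)) powr p \<le> (C * L) powr p" using p by (intro powr_mono2) auto
    then have "?w \<le> (C * L) powr p" using p by (simp add: powr_powr)
    \<comment> \<open>Here the finiteness conjunct of \<open>Carleson_PH\<close> matters: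
      \<open>enn2real\<close> sends infinity to 0, so the bound on \<open>?w\<close> alone would not
      exclude an infinite integral.\<close>
    then show ?thesis using C(2)[OF f_PH, of a] by (metis enn2real_le_iff ennreal_enn2real ennreal_leI infinity_ennreal_def)
  qed
  let ?C = "exp (c * r\<^sup>2) * (C * L) powr p + 1"
  have "emeasure \<mu> (ball a r) \<le> ennreal ?C" for a
  proof -
    have "emeasure \<mu> (ball a r) = (\<integral>\<^sup>+z. indicator (ball a r) z \<partial>\<mu>)" by (simp add: sets)
    also have "\<dots> \<le> (\<integral>\<^sup>+z. ennreal (exp (c * r\<^sup>2)) * ennreal (exp (- c * (norm (z - a))\<^sup>2)) \<partial>\<mu>)"
    proof (rule nn_integral_mono)
      fix z
      show "indicator (ball a r) z \<le> ennreal (exp (c * r\<^sup>2)) * ennreal (exp (- c * (norm (z - a))\<^sup>2))"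
      proof (cases "z \<in> ball a r")
        case True
        then have "(norm (z - a))\<^sup>2 \<le> r\<^sup>2" by (intro power_mono) (auto simp: dist_norm norm_minus_commute)
        then have "1 \<le> exp (c * r\<^sup>2) * exp (- c * (norm (z - a))\<^sup>2)"
          using c by (simp add: mult_left_mono flip: exp_add)
        then show ?thesis using True by (simp add: ennreal_leI flip: ennreal_mult ennreal_1)
      qed simp
    qed
    also have "\<dots> = ennreal (exp (c * r\<^sup>2)) * (\<integral>\<^sup>+z. ennreal (exp (- c * (norm (z - a))\<^sup>2)) \<partial>\<mu>)"
      by (rule nn_integral_cmult) measurable
    also have "(\<integral>\<^sup>+z. ennreal (exp (- c * (norm (z - a))\<^sup>2)) \<partial>\<mu>) = weighted_integral p \<alpha> \<mu> (f a)"
      unfolding weighted_integral_def weighted_f[symmetric] weighted_def ..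
    also have "ennreal (exp (c * r\<^sup>2)) * weighted_integral p \<alpha> \<mu> (f a)
        \<le> ennreal (exp (c * r\<^sup>2)) * ennreal ((C * L) powr p)"
      by (intro mult_left_mono bound) simp
    also have "\<dots> \<le> ennreal ?C" by (simp add: ennreal_leI flip: ennreal_mult)
    finally show ?thesis .
  qed
  moreover have "?C > 0" by (simp add: add_nonneg_pos)
  ultimately show ?thesis by blast
qed

theorem theorem2p7:
  fixes \<mu> :: "(complex ^ 'n) measure" and p \<alpha> r :: real
  assumes borel: "sets \<mu> = sets borel"
    and p: "p \<ge> 1" and \<alpha>: "\<alpha> > 0" and r: "r > 0"
  shows "Carleson_PH p \<alpha> \<mu> \<longleftrightarrow>
    (\<exists>C::real. C > 0 \<and> (\<forall>a. emeasure \<mu> (ball a r) \<le> ennreal C))"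
  using Carleson_imp_ball_bounded[OF borel p \<alpha>] ball_bounded_imp_Carleson[OF borel p \<alpha> r] by blast

end
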